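(* Let $G$ be a finite simple undirected graph. The graph $\mathrm{ac}(G)$ has the hull property if and only if \[ \mathrm{ac}(G)\cong\mathrm{ac}(K_{n_1})\times\cdots\times\mathrm{ac}(K_{n_k}) \] for some $n_1,\dots,n_k\in\{2,3,\dots\}$, where $K_m$ is the complete graph on $m$ vertices and $\times$ is the Cartesian product of graphs.
   Context: $\mathrm{ac}(G)$ is the graph whose vertices are the acyclic orientations of $G$, two orientations being adjacent iff they differ on exactly one edge of $G$. For a connected graph $H$ with shortest-path distance $d$, a vertex set $C$ is convex if $u,v\in C$ and $d(u,w)+d(w,v)=d(u,v)$ imply $w\in C$; $\mathrm{conv}(X)$ is the intersection of all convex sets containing $X$. $H$ has the hull property if for all vertices $u,v,w$, $|\mathrm{conv}(u,v)|\cdot|\mathrm{conv}(v,w)|\ge|\mathrm{conv}(u,w)|$. *)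

theory Defs
  imports "Graph_Theory.Graph_Theory"
begin

text \<open>
  A finite simple undirected graph is a \<^term>\<open>pair_graph\<close>: finite, loop-free and symmetric, so an
  edge between \<open>u\<close> and \<open>v\<close> is the pair of arcs \<open>(u, v)\<close>, \<open>(v, u)\<close>.
\<close>

section \<open>The graph of acyclic orientations\<close>

text \<open>An orientation is the set of arcs chosen, exactly one for each edge.\<close>

definition orientation :: "'a pair_pre_digraph \<Rightarrow> 'a rel \<Rightarrow> bool" where
  "orientation G R \<longleftrightarrow>
     R \<subseteq> parcs G \<and> (\<forall>(u, v) \<in> parcs G. (u, v) \<in> R \<longleftrightarrow> (v, u) \<notin> R)"

definition diff_edges :: "'a pair_pre_digraph \<Rightarrow> 'a rel \<Rightarrow> 'a rel \<Rightarrow> 'a set set" where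
  "diff_edges G R S = {{u, v} | u v. (u, v) \<in> parcs G \<and> \<not> ((u, v) \<in> R \<longleftrightarrow> (u, v) \<in> S)}"

definition ac :: "'a pair_pre_digraph \<Rightarrow> 'a rel pair_pre_digraph" where
  "ac G = (let A = {R. orientation G R \<and> acyclic R}
     in \<lparr> pverts = A, parcs = {(R, S). R \<in> A \<and> S \<in> A \<and> card (diff_edges G R S) = 1} \<rparr>)"

lemma pair_graph_ac:
  assumes "pair_graph G"
  shows "pair_graph (ac G)"
proof -
  interpret pair_graph G by fact
  have "{R. orientation G R \<and> acyclic R} \<subseteq> Pow (parcs G)"
    by (auto simp: orientation_def)
  then have fin: "finite {R. orientation G R \<and> acyclic R}"
    using pair_finite_arcs by (meson finite_Pow_iff finite_subset)
  have fin': "finite (parcs (ac G))"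
    by (rule finite_subset[OF _ finite_cartesian_product[OF fin fin]])
       (auto simp: ac_def Let_def)
  have sym: "diff_edges G R S = diff_edges G S R" for R S
    by (auto simp: diff_edges_def)
  show ?thesis
  proof
    show "symmetric (with_proj (ac G))"
      by (auto simp: symmetric_def sym_def ac_def Let_def sym)
  next
    fix e assume "e \<in> parcs (ac G)"
    then show "fst e \<noteq> snd e"
      by (auto simp: ac_def Let_def diff_edges_def)
  qed (use fin fin' in \<open>auto simp: ac_def Let_def\<close>)
qed


section \<open>Complete graphs and Cartesian products\<close>

definition complete_graph :: "nat \<Rightarrow> nat pair_pre_digraph" where
  "complete_graph n = \<lparr> pverts = {..<n}, parcs = {(u, v). u < n \<and> v < n \<and> u \<noteq> v} \<rparr>"

lemma complete_digraph_complete_graph: "complete_digraph n (with_proj (complete_graph n))"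
  by (auto simp: complete_digraph_pair_def complete_graph_def)

text \<open>
  Vertices are lists with one entry per factor; the empty product is the graph with one vertex.
\<close>

definition cart_prod :: "'a pair_pre_digraph list \<Rightarrow> 'a list pair_pre_digraph" where
  "cart_prod Hs = (let V = listset (map pverts Hs)
     in \<lparr> pverts = V,
          parcs = {(xs, ys). xs \<in> V \<and> ys \<in> V \<and>
            (\<exists>i < length Hs. (xs ! i, ys ! i) \<in> parcs (Hs ! i) \<and>
               (\<forall>j < length Hs. j \<noteq> i \<longrightarrow> xs ! j = ys ! j))} \<rparr>)"


section \<open>Convexity and the hull property\<close>

text \<open>The distance is infinite between vertices not joined by a walk.\<close>

definition gdist :: "'a pair_pre_digraph \<Rightarrow> 'a \<Rightarrow> 'a \<Rightarrow> ereal" where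
  "gdist H u v = wf_digraph.\<mu> (with_proj H) (\<lambda>_. 1) u v"

definition geo_convex :: "'a pair_pre_digraph \<Rightarrow> 'a set \<Rightarrow> bool" where
  "geo_convex H C \<longleftrightarrow> C \<subseteq> pverts H \<and>
     (\<forall>u \<in> C. \<forall>v \<in> C. \<forall>w \<in> pverts H.
        gdist H u w + gdist H w v = gdist H u v \<longrightarrow> w \<in> C)"

definition geo_hull :: "'a pair_pre_digraph \<Rightarrow> 'a set \<Rightarrow> 'a set" where
  "geo_hull H X = \<Inter> {C. geo_convex H C \<and> X \<subseteq> C}"

definition hull_property :: "'a pair_pre_digraph \<Rightarrow> bool" where
  "hull_property H \<longleftrightarrow> connected (with_proj H) \<and>
     (\<forall>u \<in> pverts H. \<forall>v \<in> pverts H. \<forall>w \<in> pverts H.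
        card (geo_hull H {u, v}) * card (geo_hull H {v, w}) \<ge> card (geo_hull H {u, w}))"

end

theory Submission
  imports Defs
begin

text \<open>
  Two orientations \<open>R\<close>, \<open>S\<close> have distance \<open>card (R - S)\<close>, so the hull of \<open>{R, S}\<close> is the interval
  between them, which consists of all acyclic orientations containing \<open>R \<inter> S\<close>. The hull property
  thus compares numbers of acyclic orientations extending partial ones.

  For a complete graph these are linear extensions of posets, and the claim
  \<open>e(R \<inter> T) \<le> e(R \<inter> S) e(S \<inter> T)\<close> follows by induction on the number of elements: removing a maximal
  element of \<open>R \<inter> T\<close> leaves a sum over an antichain on which the orders \<open>R \<inter> S\<close> and \<open>S \<inter> T\<close> have
  complementary comparability graphs, and \<open>\<Sum>x \<in> C. e(P - x) \<le> e(P)\<close> for every antichain \<open>C\<close> of \<open>P\<close>.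

  Conversely, the inequality passes to induced subgraphs and fails for cycles of length at least
  four and for the diamond (the complete graph on four vertices minus an edge). A graph without
  these induced subgraphs is complete or splits at a vertex, and the orientation graph of such a
  one-sum is the product of those of its parts.
\<close>

section \<open>Linear extensions and antichains\<close>

text \<open>An orientation has exactly one arc per edge, so \<open>R \<inter> S\<close> records the
  edges on which \<open>R\<close> and \<open>S\<close> agree.

  The complementarity has a simple source: two maximal elements of \<open>R \<inter> T\<close> are
  incomparable there, so \<open>R\<close> and \<open>T\<close> order them oppositely, and
  \<open>S\<close> sides with exactly one of the two. A chain of \<open>R \<inter> S\<close> among
  them is thus an antichain of \<open>S \<inter> T\<close>. The recurrence and induction leave a sum
  of products of counts; a weighted Mirsky argument bounds it by a product of two bounds, each an
  instance of the antichain inequality.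

  An isomorphism of orientation graphs does not determine the graph: all trees with the same number
  of edges give the same cube. Hence nothing about the structure of \<open>G\<close> can be read off
  from a product. The inequality is proved instead for one graph realising the product, a disjoint
  union of cliques, and carried over by preservation of distances.

  The split at a vertex comes from two non-adjacent neighbours of it: a shortest path joining such a
  pair while avoiding the vertex would yield an induced long cycle or a diamond.\<close>

definition max_els :: "'a rel \<Rightarrow> 'a set \<Rightarrow> 'a set" where
  "max_els P X = {m \<in> X. \<forall>y \<in> X. (m, y) \<notin> P}"

definition antichain :: "'a rel \<Rightarrow> 'a set \<Rightarrow> bool" where
  "antichain P C \<longleftrightarrow> (\<forall>x \<in> C. \<forall>y \<in> C. (x, y) \<notin> P)"

lemma antichain_subset: "antichain P C \<Longrightarrow> D \<subseteq> C \<Longrightarrow> antichain P D"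
  unfolding antichain_def by blast

lemma max_els_subset: "max_els P X \<subseteq> X"
  by (auto simp: max_els_def)

lemma ex_max_above:
  assumes "trans P" "irrefl P" "finite X" "x \<in> X"
  shows "\<exists>m \<in> max_els P X. m = x \<or> (x, m) \<in> P"
proof -
  have ac: "acyclic P"
    using assms(1,2) by (simp add: acyclic_irrefl)
  define A where "A = {y \<in> X. y = x \<or> (x, y) \<in> P}"
  have "finite (P \<inter> X \<times> X)" using assms(3) by auto
  moreover have "acyclic (P \<inter> X \<times> X)" using ac by (rule acyclic_subset) auto
  ultimately have "wf ((P \<inter> X \<times> X)\<inverse>)" by (rule finite_acyclic_wf_converse)
  moreover have "x \<in> A" using assms(4) by (auto simp: A_def)
  ultimately obtain m where m: "m \<in> A" "\<And>y. (y, m) \<in> (P \<inter> X \<times> X)\<inverse> \<Longrightarrow> y \<notin> A"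
    by (metis wfE_min)
  have "m \<in> max_els P X"
    using m assms(1) unfolding A_def max_els_def trans_def by blast
  then show ?thesis using m(1) by (auto simp: A_def)
qed

definition maxs_above :: "'a rel \<Rightarrow> 'a set \<Rightarrow> 'a set \<Rightarrow> 'a set" where
  "maxs_above P X C = {m \<in> max_els P X. \<exists>x \<in> C. m = x \<or> (x, m) \<in> P}"

text \<open>
  The function \<open>e\<close> obeys the recurrence of the number of linear extensions. In terms of promotion
  paths, which are maximal chains: every path through \<open>C\<close> ends in a maximal element above \<open>C\<close>, and
  meets an antichain at most once.
\<close>

lemma sum_antichain_le_sum_maxs_above:
  fixes e :: "'a set \<Rightarrow> nat"
  assumes P: "trans P" "irrefl P"
    and rec: "\<And>X. finite X \<Longrightarrow> X \<noteq> {} \<Longrightarrow> e X = (\<Sum>m \<in> max_els P X. e (X - {m}))"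
  shows "finite X \<Longrightarrow> C \<subseteq> X \<Longrightarrow> antichain P C \<Longrightarrow>
    (\<Sum>x \<in> C. e (X - {x})) \<le> (\<Sum>m \<in> maxs_above P X C. e (X - {m}))"
proof (induction "card X" arbitrary: X C rule: less_induct)
  case less
  have finX: "finite X" by fact
  define M where "M = max_els P X"
  define C' where "C' = C - M"
  define U where "U = maxs_above P X C'"
  have finM: "finite M" and MX: "M \<subseteq> X"
    using finX by (auto simp: M_def max_els_def)
  have finC: "finite C" using less.prems finX by (auto intro: finite_subset)
  then have finC': "finite C'" by (simp add: C'_def)
  have C'X: "C' \<subseteq> X" and antiC': "antichain P C'"
    using less.prems antichain_subset[of P C C'] by (auto simp: C'_def)
  have UM: "U \<subseteq> M" by (auto simp: U_def maxs_above_def M_def)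
  have finU: "finite U" using UM finM by (rule finite_subset)
  have IH: "(\<Sum>x \<in> C'. e (X - {m} - {x})) \<le> (\<Sum>u \<in> maxs_above P (X - {m}) C'. e (X - {m} - {u}))"
    if "m \<in> M" for m
  proof -
    have "card (X - {m}) < card X"
      using that MX finX by (meson card_Diff1_less subsetD)
    moreover have "C' \<subseteq> X - {m}" using C'X that by (auto simp: C'_def)
    ultimately show ?thesis using less.hyps[of "X - {m}" C'] finX antiC' by auto
  qed
  \<comment> \<open>Deleting \<open>m\<close> outside \<open>U\<close> exposes no new maximal
    element above \<open>C'\<close>: an element above \<open>C'\<close> and below \<open>m\<close>
    would put \<open>m\<close> into \<open>U\<close>.\<close>
  have maxs_out: "maxs_above P (X - {m}) C' \<subseteq> U" if "m \<in> M - U" for m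
  proof
    fix u assume u: "u \<in> maxs_above P (X - {m}) C'"
    then obtain x where x: "x \<in> C'" "u = x \<or> (x, u) \<in> P" "u \<in> max_els P (X - {m})"
      by (auto simp: maxs_above_def)
    have um: "(u, m) \<notin> P"
    proof
      assume "(u, m) \<in> P"
      then have "(x, m) \<in> P" using x(2) P(1) by (auto dest: transD)
      then have "m \<in> U" using x(1) that by (auto simp: U_def maxs_above_def M_def)
      then show False using that by simp
    qed
    then have "u \<in> max_els P X" using x(3) by (auto simp: max_els_def)
    then show "u \<in> U" using x(1,2) by (auto simp: U_def maxs_above_def)
  qed
  have out: "(\<Sum>x \<in> C'. e (X - {m} - {x})) \<le> (\<Sum>u \<in> U. e (X - {m} - {u}))" if "m \<in> M - U" for m
    using IH[of m] sum_mono2[OF finU maxs_out[OF that], of "\<lambda>u. e (X - {m} - {u})"] that by fastforce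
  \<comment> \<open>Deleting \<open>m\<close> in \<open>U\<close> may expose new maximal elements
    above \<open>C'\<close>, but those of \<open>M - U\<close> stay maximal and are not above
    \<open>C'\<close>. The recurrence for \<open>X - {m}\<close> therefore has room for both
    sums.\<close>
  have ins: "(\<Sum>x \<in> C'. e (X - {m} - {x})) + (\<Sum>u \<in> M - U. e (X - {m} - {u})) \<le> e (X - {m})"
    if mU: "m \<in> U" for m
  proof -
    have mM: "m \<in> M" using mU UM by auto
    obtain x where x: "x \<in> C'" using mU unfolding U_def maxs_above_def by blast
    have ne: "X - {m} \<noteq> {}" using x mM C'X by (auto simp: C'_def)
    let ?M = "max_els P (X - {m})" and ?U = "maxs_above P (X - {m}) C'"
    have finM': "finite ?M" using finX by (auto simp: max_els_def)
    have disj: "?U \<inter> (M - U) = {}"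
      by (auto simp: U_def M_def maxs_above_def)
    have sub: "?U \<union> (M - U) \<subseteq> ?M"
      using that by (auto simp: U_def M_def maxs_above_def max_els_def)
    have "(\<Sum>x \<in> C'. e (X - {m} - {x})) + (\<Sum>u \<in> M - U. e (X - {m} - {u})) \<le>
        (\<Sum>u \<in> ?U. e (X - {m} - {u})) + (\<Sum>u \<in> M - U. e (X - {m} - {u}))"
      using IH[OF mM] by simp
    also have "\<dots> = (\<Sum>u \<in> ?U \<union> (M - U). e (X - {m} - {u}))"
      using disj finM' sub finM by (intro sum.union_disjoint[symmetric]) (auto intro: finite_subset)
    also have "\<dots> \<le> (\<Sum>u \<in> ?M. e (X - {m} - {u}))"
      by (rule sum_mono2[OF finM' sub]) simp
    also have "\<dots> = e (X - {m})" using rec[of "X - {m}"] ne finX by simp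
    finally show ?thesis .
  qed
  have maxs_del: "max_els P (X - {x}) = M" if "x \<in> C'" for x
  proof -
    have xX: "x \<in> X" "x \<notin> M" using that C'X by (auto simp: C'_def)
    obtain z where z: "z \<in> M" "(x, z) \<in> P"
      using ex_max_above[OF P finX xX(1)] xX(2) by (auto simp: M_def)
    have "m \<in> M" if m: "m \<in> max_els P (X - {x})" for m
    proof -
      have "(m, x) \<notin> P"
      proof
        assume "(m, x) \<in> P"
        then have "(m, z) \<in> P" using z P(1) by (auto dest: transD)
        moreover have "z \<in> X - {x}" using z MX xX by auto
        ultimately show False using m by (auto simp: max_els_def)
      qed
      then show ?thesis using m by (auto simp: max_els_def M_def)
    qed
    then show ?thesis using xX by (auto simp: max_els_def M_def)
  qed
  have exp: "e (X - {x}) = (\<Sum>m \<in> M. e (X - {m} - {x}))" if "x \<in> C'" for x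
  proof -
    have xX: "x \<in> X" "x \<notin> M" using that C'X by (auto simp: C'_def)
    have "X - {x} \<noteq> {}"
      using ex_max_above[OF P finX xX(1)] xX MX by (auto simp: M_def)
    then have "e (X - {x}) = (\<Sum>m \<in> M. e (X - {x} - {m}))"
      using rec[of "X - {x}"] finX maxs_del[OF that] by simp
    moreover have "X - {x} - {m} = X - {m} - {x}" for m by auto
    ultimately show ?thesis by simp
  qed
  \<comment> \<open>Double counting over pairs of deleted elements. The terms with \<open>m\<close>
    outside \<open>U\<close> are bounded by mixed pairs from \<open>M - U\<close> and
    \<open>U\<close>; after exchanging the two deletions these are the extra summands that
    \<open>ins\<close> absorbs.\<close>
  have "(\<Sum>x \<in> C'. e (X - {x})) = (\<Sum>m \<in> M. \<Sum>x \<in> C'. e (X - {m} - {x}))"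
    using exp by (simp add: sum.swap[of _ M])
  also have "\<dots> = (\<Sum>m \<in> M - U. \<Sum>x \<in> C'. e (X - {m} - {x})) + (\<Sum>m \<in> U. \<Sum>x \<in> C'. e (X - {m} - {x}))"
    by (rule sum.subset_diff[OF UM finM])
  also have "\<dots> \<le> (\<Sum>m \<in> M - U. \<Sum>u \<in> U. e (X - {m} - {u})) + (\<Sum>m \<in> U. \<Sum>x \<in> C'. e (X - {m} - {x}))"
    using out by (intro add_right_mono sum_mono) auto
  also have "(\<Sum>m \<in> M - U. \<Sum>u \<in> U. e (X - {m} - {u})) = (\<Sum>u \<in> U. \<Sum>m \<in> M - U. e (X - {u} - {m}))"
  proof -
    have "X - {x} - {m} = X - {m} - {x}" for m x :: 'a by auto
    then show ?thesis by (subst sum.swap) simp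
  qed
  also have "\<dots> + (\<Sum>m \<in> U. \<Sum>x \<in> C'. e (X - {m} - {x})) =
      (\<Sum>m \<in> U. (\<Sum>x \<in> C'. e (X - {m} - {x})) + (\<Sum>u \<in> M - U. e (X - {m} - {u})))"
    by (simp add: sum.distrib add.commute)
  also have "\<dots> \<le> (\<Sum>m \<in> U. e (X - {m}))"
    by (intro sum_mono ins)
  finally have main: "(\<Sum>x \<in> C'. e (X - {x})) \<le> (\<Sum>m \<in> U. e (X - {m}))" .
  \<comment> \<open>A maximal element of \<open>C\<close> above a non-maximal one would be
    comparable to it, against the antichain condition.\<close>
  have dis: "(C \<inter> M) \<inter> U = {}"
  proof (safe, goal_cases)
    case (1 m)
    then obtain x where x: "x \<in> C'" "m = x \<or> (x, m) \<in> P"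
      by (auto simp: U_def maxs_above_def)
    moreover have "m \<noteq> x" using x(1) 1 by (auto simp: C'_def)
    ultimately show ?case using less.prems(3) 1 by (auto simp: antichain_def C'_def)
  qed
  have sub: "(C \<inter> M) \<union> U \<subseteq> maxs_above P X C"
    by (auto simp: U_def maxs_above_def C'_def M_def)
  have finA: "finite (maxs_above P X C)"
    using finM by (rule finite_subset[rotated]) (auto simp: maxs_above_def M_def)
  have "(\<Sum>x \<in> C. e (X - {x})) = (\<Sum>x \<in> C'. e (X - {x})) + (\<Sum>x \<in> C \<inter> M. e (X - {x}))"
    unfolding C'_def using sum.subset_diff[of "C \<inter> M" C "\<lambda>x. e (X - {x})"] finC
    by (simp add: Diff_Int)
  also have "\<dots> \<le> (\<Sum>x \<in> U. e (X - {x})) + (\<Sum>x \<in> C \<inter> M. e (X - {x}))"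
    using main by simp
  also have "\<dots> = (\<Sum>x \<in> (C \<inter> M) \<union> U. e (X - {x}))"
    using finC finU dis by (simp add: sum.union_disjoint add.commute)
  also have "\<dots> \<le> (\<Sum>m \<in> maxs_above P X C. e (X - {m}))"
    by (rule sum_mono2[OF finA sub]) simp
  finally show ?case .
qed

text \<open>The sum over \<open>maxs_above\<close> was the strengthening that lets the induction
  close, since it tells which maximal elements pay for \<open>C\<close>. Applications only compare
  with the full recurrence sum.\<close>

lemma sum_antichain_le:
  fixes e :: "'a set \<Rightarrow> nat"
  assumes P: "trans P" "irrefl P"
    and rec: "\<And>X. finite X \<Longrightarrow> X \<noteq> {} \<Longrightarrow> e X = (\<Sum>m \<in> max_els P X. e (X - {m}))"
    and X: "finite X" "C \<subseteq> X" "antichain P C"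
  shows "(\<Sum>x \<in> C. e (X - {x})) \<le> e X"
proof (cases "X = {}")
  case False
  have "(\<Sum>x \<in> C. e (X - {x})) \<le> (\<Sum>m \<in> maxs_above P X C. e (X - {m}))"
    by (rule sum_antichain_le_sum_maxs_above[OF P rec X])
  also have "\<dots> \<le> (\<Sum>m \<in> max_els P X. e (X - {m}))"
    using X(1) by (intro sum_mono2) (auto simp: maxs_above_def max_els_def)
  also have "\<dots> = e X" using rec X(1) False by simp
  finally show ?thesis .
qed (use X in simp)

text \<open>
  A weighted form of Mirsky's theorem: lowering \<open>b\<close> by one on the minimal elements of its support
  lowers the weight of every chain, and splits off an antichain.
\<close>

lemma weighted_mirsky:
  fixes a b :: "'a \<Rightarrow> nat"
  assumes "finite Y" "trans P" "irrefl P"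
    and anti: "\<And>A. A \<subseteq> Y \<Longrightarrow> antichain P A \<Longrightarrow> (\<Sum>x \<in> A. a x) \<le> \<alpha>"
    and chain: "\<And>Z. Z \<subseteq> Y \<Longrightarrow> (\<forall>x \<in> Z. \<forall>y \<in> Z. x = y \<or> (x, y) \<in> P \<or> (y, x) \<in> P) \<Longrightarrow>
      (\<Sum>x \<in> Z. b x) \<le> \<beta>"
  shows "(\<Sum>x \<in> Y. a x * b x) \<le> \<alpha> * \<beta>"
  using chain
proof (induction \<beta> arbitrary: b)
  case 0
  have "b x = 0" if "x \<in> Y" for x
    using 0[of "{x}"] that by auto
  then show ?case by simp
next
  case (Suc \<beta>)
  define S where "S = {x \<in> Y. b x > 0}"
  define A where "A = max_els (P\<inverse>) S"
  have finS: "finite S" using assms(1) by (auto simp: S_def)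
  have AS: "A \<subseteq> S" and SY: "S \<subseteq> Y" by (auto simp: A_def S_def max_els_def)
  have finA: "finite A" using AS finS by (rule finite_subset)
  define b' where "b' x = (if x \<in> A then b x - 1 else b x)" for x
  have bb': "b x = b' x + (if x \<in> A then 1 else 0)" for x
    using AS by (auto simp: b'_def S_def)
  have "(\<Sum>x \<in> Y. a x * b' x) \<le> \<alpha> * \<beta>"
  proof (rule Suc.IH)
    fix Z assume Z: "Z \<subseteq> Y" and ch: "\<forall>x \<in> Z. \<forall>y \<in> Z. x = y \<or> (x, y) \<in> P \<or> (y, x) \<in> P"
    have finZ: "finite Z" using Z assms(1) by (rule finite_subset)
    define Z' where "Z' = Z \<inter> S"
    have zz: "sum b' Z = sum b' Z'"
      using finZ Z by (intro sum.mono_neutral_right) (auto simp: Z'_def b'_def S_def)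
    have finZ': "finite Z'" using finZ by (simp add: Z'_def)
    show "sum b' Z \<le> \<beta>"
    proof (cases "Z' \<inter> A = {}")
      case False
      then obtain z where z: "z \<in> Z'" "z \<in> A" by auto
      have "sum b' Z' + 1 \<le> sum b' Z' + (\<Sum>x \<in> Z'. if x \<in> A then 1 else 0)"
        using member_le_sum[of z Z' "\<lambda>x. if x \<in> A then 1 else 0 :: nat"] z finZ' by simp
      also have "\<dots> = sum b Z'" by (simp add: bb' sum.distrib)
      also have "\<dots> \<le> Suc \<beta>"
        using Suc.prems[of Z'] Z ch by (auto simp: Z'_def)
      finally show ?thesis using zz by simp
    next
      case True
      show ?thesis
      proof (cases "Z' = {}")
        case True then show ?thesis using zz by simp
      next
        case False
        then obtain z0 where "z0 \<in> Z'" by auto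
        have cv: "trans (P\<inverse>)" "irrefl (P\<inverse>)" using assms by (auto simp: irrefl_def)
        \<comment> \<open>A chain avoiding \<open>A\<close> can be prolonged: its least element
          \<open>z\<close> lies strictly above some \<open>w\<close> in \<open>A\<close>, and adding
          \<open>w\<close> gives a chain with at least one more unit of weight. The bound for that
          chain leaves \<open>\<beta>\<close> for \<open>Z'\<close>.\<close>
        obtain z where z: "z \<in> max_els (P\<inverse>) Z'"
          using ex_max_above[OF cv finZ' \<open>z0 \<in> Z'\<close>] by blast
        then have zS: "z \<in> S" "z \<in> Z'" by (auto simp: max_els_def Z'_def)
        obtain w where w: "w \<in> A" "w = z \<or> (w, z) \<in> P"
          using ex_max_above[OF cv finS zS(1)] by (auto simp: A_def)
        then have wz: "(w, z) \<in> P" using zS(2) True by auto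
        have below: "(w, y) \<in> P" if y: "y \<in> Z'" for y
        proof -
          have "y = z \<or> (y, z) \<in> P \<or> (z, y) \<in> P" using ch y zS(2) by (auto simp: Z'_def)
          moreover have "(y, z) \<notin> P" using z y by (auto simp: max_els_def)
          ultimately show ?thesis using wz assms(2) by (auto dest: transD)
        qed
        have wZ: "w \<notin> Z'" using w(1) True by auto
        have bw: "b w \<ge> 1" using w AS by (auto simp: S_def)
        have "sum b (insert w Z') \<le> Suc \<beta>"
          using w AS SY ch below Z by (intro Suc.prems) (auto simp: Z'_def)
        then have "sum b Z' \<le> \<beta>" using wZ finZ' bw by simp
        moreover have "sum b' Z' \<le> sum b Z'" by (intro sum_mono) (simp add: b'_def)
        ultimately show ?thesis using zz by simp
      qed
    qed
  qed
  moreover have "sum a A \<le> \<alpha>"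
    using AS SY by (intro anti) (auto simp: A_def antichain_def max_els_def)
  moreover have "(\<Sum>x \<in> Y. a x * b x) = (\<Sum>x \<in> Y. a x * b' x) + sum a A"
  proof -
    have "(\<Sum>x \<in> Y. a x * b x) = (\<Sum>x \<in> Y. a x * b' x) + (\<Sum>x \<in> Y. if x \<in> A then a x else 0)"
      unfolding sum.distrib[symmetric] by (intro sum.cong) (auto simp: bb' algebra_simps)
    also have "(\<Sum>x \<in> Y. if x \<in> A then a x else 0) = sum a A"
      using assms(1) AS SY by (simp add: sum.If_cases Int_absorb1 Collect_mem_eq)
    finally show ?thesis .
  qed
  ultimately show ?case by simp
qed

section \<open>Complete graphs\<close>

text \<open>Working with the arc relation alone turns one-sums into unions and induced subgraphs
  into intersections.\<close>

definition aor :: "'a rel \<Rightarrow> 'a rel set" where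
  "aor E = {R. R \<subseteq> E \<and> (\<forall>(u, v) \<in> E. (u, v) \<in> R \<longleftrightarrow> (v, u) \<notin> R) \<and> acyclic R}"

definition aor_ext :: "'a rel \<Rightarrow> 'a rel \<Rightarrow> 'a rel set" where
  "aor_ext E P = {T \<in> aor E. P \<subseteq> T}"

definition hull_ineq :: "'a rel \<Rightarrow> bool" where
  "hull_ineq E \<longleftrightarrow> (\<forall>R \<in> aor E. \<forall>S \<in> aor E. \<forall>T \<in> aor E.
     card (aor_ext E (R \<inter> T)) \<le> card (aor_ext E (R \<inter> S)) * card (aor_ext E (S \<inter> T)))"

definition clique :: "'a set \<Rightarrow> 'a rel" where
  "clique X = {(x, y). x \<in> X \<and> y \<in> X \<and> x \<noteq> y}"

text \<open>Potentials certify acyclicity of glued relations: two of them can be shifted to agree at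
  a point or stacked one above the other. Integer values make the shift by subtraction
  possible.\<close>

lemma acyclic_if_rank:
  fixes f :: "'a \<Rightarrow> int"
  assumes "\<And>x y. (x, y) \<in> R \<Longrightarrow> f x < f y"
  shows "acyclic R"
proof -
  have "f x < f y" if "(x, y) \<in> R\<^sup>+" for x y
    using that by (induction rule: trancl_induct) (use assms in fastforce)+
  then show ?thesis by (fastforce simp: acyclic_def)
qed

lemma ex_rank_if_acyclic:
  assumes "finite R" "acyclic R"
  obtains f :: "'a \<Rightarrow> int" where "\<And>x y. (x, y) \<in> R \<Longrightarrow> f x < f y"
proof
  fix x y assume xy: "(x, y) \<in> R"
  let ?B = "\<lambda>x. {z. (z, x) \<in> R\<^sup>+}"
  have "finite (?B z)" for z
    by (rule finite_subset[of _ "fst ` (R\<^sup>+)"]) (use assms(1) in force)+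
  moreover have "?B x \<subset> ?B y"
    using xy assms(2) by (auto simp: acyclic_def intro: trancl_into_trancl)
  ultimately show "int (card (?B x)) < int (card (?B y))"
    by (simp add: psubset_card_mono)
qed

lemma finite_aor: "finite E \<Longrightarrow> finite (aor E)"
  by (rule finite_subset[of _ "Pow E"]) (auto simp: aor_def)

lemma finite_ext: "finite E \<Longrightarrow> finite (aor_ext E P)"
  by (rule finite_subset[OF _ finite_aor[of E]]) (auto simp: aor_ext_def)

lemma finite_clique: "finite X \<Longrightarrow> finite (clique X)"
  by (rule finite_subset[of _ "X \<times> X"]) (auto simp: clique_def)

lemma aor_sub: "R \<in> aor E \<Longrightarrow> R \<subseteq> E"
  and aor_acyclic: "R \<in> aor E \<Longrightarrow> acyclic R"
  and aor_iff: "R \<in> aor E \<Longrightarrow> (u, v) \<in> E \<Longrightarrow> (u, v) \<in> R \<longleftrightarrow> (v, u) \<notin> R"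
  by (auto simp: aor_def)

lemma aor_asym: "R \<in> aor E \<Longrightarrow> (u, v) \<in> R \<Longrightarrow> (v, u) \<notin> R"
  by (auto simp: aor_def)

lemma aor_subset_eq:
  assumes "R \<in> aor E" "S \<in> aor E" "R \<subseteq> S"
  shows "R = S"
proof -
  have "(u, v) \<in> R" if "(u, v) \<in> S" for u v
    using assms that aor_iff[of R E u v] aor_asym[of S E u v] by (auto simp: aor_def)
  then show ?thesis using assms(3) by auto
qed

text \<open>Acyclic tournaments are strict linear orders: if \<open>(x, z)\<close> were missing,
  then \<open>(z, x)\<close> would close a directed triangle.\<close>

lemma clique_aor_trans:
  assumes "R \<in> aor (clique X)"
  shows "trans R" "irrefl R"
proof -
  have ac: "acyclic R" using assms by (rule aor_acyclic)
  then show "irrefl R" by (auto simp: irrefl_def acyclic_def)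
  show "trans R"
  proof (rule transI)
    fix x y z assume xy: "(x, y) \<in> R" and yz: "(y, z) \<in> R"
    have "(x, z) \<in> R\<^sup>+" using xy yz by (meson trancl.simps)
    then have nzx: "(z, x) \<notin> R" and "x \<noteq> z"
      using ac by (auto simp: acyclic_def intro: trancl_into_trancl)
    moreover have "x \<in> X" "z \<in> X" using xy yz aor_sub[OF assms] by (auto simp: clique_def)
    ultimately show "(x, z) \<in> R" using aor_iff[OF assms, of x z] by (auto simp: clique_def)
  qed
qed

lemma clique_aor_total:
  assumes "R \<in> aor (clique X)" "x \<in> X" "y \<in> X" "x \<noteq> y"
  shows "(x, y) \<in> R \<longleftrightarrow> (y, x) \<notin> R"
  using aor_iff[OF assms(1), of x y] assms by (auto simp: clique_def)

text \<open>For an order \<open>P\<close> this is the number of linear extensions of its restriction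
  to \<open>X\<close>.\<close>

definition num_ext :: "'a rel \<Rightarrow> 'a set \<Rightarrow> nat" where
  "num_ext P X = card (aor_ext (clique X) (P \<inter> X \<times> X))"

lemma num_ext_empty: "num_ext P {} = 1"
proof -
  have "aor_ext (clique {}) (P \<inter> {} \<times> {}) = {{}}"
    by (auto simp: aor_ext_def aor_def clique_def acyclic_def)
  then show ?thesis by (simp add: num_ext_def)
qed

lemma clique_aor_insert:
  assumes m: "m \<in> X" and T: "T \<in> aor (clique (X - {m}))"
  shows "T \<union> (X - {m}) \<times> {m} \<in> aor (clique X)"
proof -
  let ?T = "T \<union> (X - {m}) \<times> {m}"
  have sub: "T \<subseteq> (X - {m}) \<times> (X - {m})" using aor_sub[OF T] by (auto simp: clique_def)
  have tr: "trans T" "irrefl T" using clique_aor_trans[OF T] by auto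
  have "trans ?T"
    using tr(1) sub unfolding trans_def by blast
  moreover have "irrefl ?T" using tr(2) by (auto simp: irrefl_def)
  ultimately have "acyclic ?T" by (simp add: acyclic_irrefl)
  moreover have "?T \<subseteq> clique X" using sub m aor_sub[OF T] by (auto simp: clique_def)
  moreover have "(u, v) \<in> ?T \<longleftrightarrow> (v, u) \<notin> ?T" if "(u, v) \<in> clique X" for u v
  proof (cases "u = m \<or> v = m")
    case True then show ?thesis using that sub by (auto simp: clique_def)
  next
    case False then show ?thesis using that clique_aor_total[OF T, of u v] by (auto simp: clique_def)
  qed
  ultimately show ?thesis by (auto simp: aor_def)
qed

lemma clique_aor_restrict:
  assumes "T \<in> aor (clique X)"
  shows "T \<inter> Y \<times> Y \<in> aor (clique (X \<inter> Y))"
  using assms acyclic_subset[of T "T \<inter> Y \<times> Y"]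
  by (auto simp: aor_def clique_def)

text \<open>Linear extensions are sorted by their top element, which must be maximal for
  \<open>P\<close>. Deleting it leaves an extension on the remaining set, and putting it back on top
  inverts the deletion.\<close>

lemma num_ext_rec:
  assumes "finite X" "X \<noteq> {}"
  shows "num_ext P X = (\<Sum>m \<in> max_els P X. num_ext P (X - {m}))"
proof -
  define L where "L X = aor_ext (clique X) (P \<inter> X \<times> X)" for X
  define f where "f m T = T \<union> (X - {m}) \<times> {m}" for m T
  have fin: "finite (L Y)" if "finite Y" for Y
    using that by (simp add: L_def finite_ext finite_clique)
  have inside: "T \<subseteq> (X - {m}) \<times> (X - {m})" if "T \<in> L (X - {m})" for T m
    using that by (auto simp: L_def aor_ext_def aor_def clique_def)
  have "L X = (\<Union>m \<in> max_els P X. f m ` L (X - {m}))"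
  proof (intro equalityI subsetI)
    fix T assume T: "T \<in> L X"
    then have Ta: "T \<in> aor (clique X)" and PT: "P \<inter> X \<times> X \<subseteq> T"
      by (auto simp: L_def aor_ext_def)
    obtain x where "x \<in> X" using assms(2) by auto
    then obtain m where m: "m \<in> max_els T X"
      using ex_max_above[OF clique_aor_trans[OF Ta] assms(1)] by blast
    have mX: "m \<in> X" using m by (auto simp: max_els_def)
    have toM: "(x, m) \<in> T" if "x \<in> X - {m}" for x
      using that m clique_aor_total[OF Ta, of x m] by (auto simp: max_els_def)
    have "T = f m (T \<inter> (X - {m}) \<times> (X - {m}))"
      using toM m aor_sub[OF Ta] by (auto simp: f_def max_els_def clique_def)
    moreover have "T \<inter> (X - {m}) \<times> (X - {m}) \<in> L (X - {m})"
      using clique_aor_restrict[OF Ta, of "X - {m}"] PT by (auto simp: L_def aor_ext_def Int_absorb1)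
    moreover have "m \<in> max_els P X" using m PT by (auto simp: max_els_def)
    ultimately show "T \<in> (\<Union>m \<in> max_els P X. f m ` L (X - {m}))" by blast
  next
    fix T assume "T \<in> (\<Union>m \<in> max_els P X. f m ` L (X - {m}))"
    then obtain m T' where m: "m \<in> max_els P X" and T': "T' \<in> L (X - {m})" "T = f m T'" by auto
    have "T' \<in> aor (clique (X - {m}))" using T'(1) by (auto simp: L_def aor_ext_def)
    moreover have "m \<in> X" using m by (auto simp: max_els_def)
    ultimately have "T \<in> aor (clique X)" using clique_aor_insert T'(2) by (auto simp: f_def)
    moreover have "P \<inter> X \<times> X \<subseteq> T"
      using m T' by (auto simp: max_els_def L_def aor_ext_def f_def)
    ultimately show "T \<in> L X" by (simp add: L_def aor_ext_def)
  qed
  moreover have "card (\<Union>m \<in> max_els P X. f m ` L (X - {m})) =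
      (\<Sum>m \<in> max_els P X. card (f m ` L (X - {m})))"
  proof (rule card_UN_disjoint)
    show "finite (max_els P X)" using assms(1) by (auto simp: max_els_def)
    show "\<forall>m \<in> max_els P X. finite (f m ` L (X - {m}))" using fin assms(1) by auto
    show "\<forall>m \<in> max_els P X. \<forall>n \<in> max_els P X. m \<noteq> n \<longrightarrow>
        f m ` L (X - {m}) \<inter> f n ` L (X - {n}) = {}"
    proof (intro ballI impI, rule ccontr)
      fix m n assume mn: "m \<in> max_els P X" "n \<in> max_els P X" "m \<noteq> n"
        and "f m ` L (X - {m}) \<inter> f n ` L (X - {n}) \<noteq> {}"
      then obtain S T where ST: "S \<in> L (X - {m})" "T \<in> L (X - {n})" "f m S = f n T" by auto
      have "(n, m) \<in> f m S" using mn by (auto simp: f_def max_els_def)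
      moreover have "(n, m) \<notin> f n T" using mn inside[OF ST(2)] by (auto simp: f_def)
      ultimately show False using ST(3) by simp
    qed
  qed
  moreover have "card (f m ` L (X - {m})) = card (L (X - {m}))" for m
  proof (rule card_image, rule inj_onI)
    fix S T assume "S \<in> L (X - {m})" "T \<in> L (X - {m})" "f m S = f m T"
    then show "S = T" using inside[of S m] inside[of T m] by (auto simp: f_def)
  qed
  ultimately show ?thesis by (simp add: num_ext_def L_def)
qed

text \<open>Only the ground set \<open>X\<close> shrinks in the induction; \<open>R\<close>,
  \<open>S\<close>, \<open>T\<close> stay linear orders on \<open>V\<close>, so their pairwise
  intersections remain strict orders throughout.\<close>

lemma num_ext_le_mult:
  assumes R: "R \<in> aor (clique V)" and S: "S \<in> aor (clique V)" and T: "T \<in> aor (clique V)"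
  shows "finite X \<Longrightarrow> X \<subseteq> V \<Longrightarrow> num_ext (R \<inter> T) X \<le> num_ext (R \<inter> S) X * num_ext (S \<inter> T) X"
proof (induction "card X" arbitrary: X rule: less_induct)
  case less
  show ?case
  proof (cases "X = {}")
    case True then show ?thesis by (simp add: num_ext_empty)
  next
    case False
    note finX = less.prems(1)
    let ?Y = "max_els (R \<inter> T) X"
    let ?a = "\<lambda>x. num_ext (R \<inter> S) (X - {x})" and ?b = "\<lambda>x. num_ext (S \<inter> T) (X - {x})"
    have YX: "?Y \<subseteq> X" by (rule max_els_subset)
    have tri: "trans (A \<inter> B)" "irrefl (A \<inter> B)" if "A \<in> aor (clique V)" "B \<in> aor (clique V)" for A B
      using that clique_aor_trans[of A V] clique_aor_trans[of B V]
      by (auto simp: irrefl_def intro: trans_Int)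
    \<comment> \<open>Maximal elements of \<open>R \<inter> T\<close> are pairwise incomparable in
      it, so the two linear orders disagree on each pair.\<close>
    have incomp: "(x, y) \<in> R \<longleftrightarrow> (y, x) \<in> T" if "x \<in> ?Y" "y \<in> ?Y" "x \<noteq> y" for x y
    proof -
      have V: "x \<in> V" "y \<in> V" and "(x, y) \<notin> R \<inter> T" "(y, x) \<notin> R \<inter> T"
        using that less.prems by (auto simp: max_els_def)
      then show ?thesis
        using clique_aor_total[OF R V that(3)] clique_aor_total[OF T V that(3)] by auto
    qed
    have "num_ext (R \<inter> T) X = (\<Sum>x \<in> ?Y. num_ext (R \<inter> T) (X - {x}))"
      by (rule num_ext_rec[OF finX False])
    also have "\<dots> \<le> (\<Sum>x \<in> ?Y. ?a x * ?b x)"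
      using less.prems YX finX by (intro sum_mono less.hyps card_Diff1_less) auto
    also have "\<dots> \<le> num_ext (R \<inter> S) X * num_ext (S \<inter> T) X"
    proof (rule weighted_mirsky[of _ "R \<inter> S"])
      show "finite ?Y" using YX finX by (rule finite_subset)
      show "trans (R \<inter> S)" "irrefl (R \<inter> S)" using tri R S by auto
      show "sum ?a A \<le> num_ext (R \<inter> S) X" if "A \<subseteq> ?Y" "antichain (R \<inter> S) A" for A
        using that YX finX by (intro sum_antichain_le[OF tri[OF R S] num_ext_rec]) auto
      show "sum ?b Z \<le> num_ext (S \<inter> T) X"
        if Z: "Z \<subseteq> ?Y" and ch: "\<forall>x \<in> Z. \<forall>y \<in> Z. x = y \<or> (x, y) \<in> R \<inter> S \<or> (y, x) \<in> R \<inter> S" for Z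
      proof (rule sum_antichain_le[OF tri[OF S T] num_ext_rec])
        \<comment> \<open>On a chain of \<open>R \<inter> S\<close> the order \<open>S\<close>
          agrees with \<open>R\<close> and hence opposes \<open>T\<close> on every pair.\<close>
        show "antichain (S \<inter> T) Z"
          unfolding antichain_def
        proof (intro ballI notI)
          fix x y assume xy: "x \<in> Z" "y \<in> Z" "(x, y) \<in> S \<inter> T"
          then have "x \<noteq> y" using tri(2)[OF S T] by (auto simp: irrefl_def)
          moreover have "(y, x) \<in> R" using incomp[of y x] xy Z \<open>x \<noteq> y\<close> by auto
          then have "(x, y) \<notin> R" using R by (auto dest: aor_asym)
          ultimately have "(y, x) \<in> S" using ch xy by auto
          then show False using xy S by (auto dest: aor_asym)
        qed
      qed (use finX Z YX in auto)
    qed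
    finally show ?thesis .
  qed
qed

theorem hull_ineq_clique:
  assumes "finite V"
  shows "hull_ineq (clique V)"
  unfolding hull_ineq_def
proof (intro ballI)
  fix R S T assume *: "R \<in> aor (clique V)" "S \<in> aor (clique V)" "T \<in> aor (clique V)"
  have "A \<inter> V \<times> V = A" if "A \<subseteq> clique V" for A
    using that by (auto simp: clique_def)
  moreover have "A \<inter> B \<subseteq> clique V" if "A \<in> aor (clique V)" for A B
    using aor_sub[OF that] by auto
  ultimately show "card (aor_ext (clique V) (R \<inter> T)) \<le>
      card (aor_ext (clique V) (R \<inter> S)) * card (aor_ext (clique V) (S \<inter> T))"
    using num_ext_le_mult[OF * assms order_refl] * by (simp add: num_ext_def)
qed

section \<open>One-sums, induced subgraphs and relabelling\<close>

definition simple :: "'a rel \<Rightarrow> bool" where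
  "simple E \<longleftrightarrow> finite E \<and> sym E \<and> irrefl E"

lemma simpleD: "simple E \<Longrightarrow> finite E" "simple E \<Longrightarrow> (x, y) \<in> E \<Longrightarrow> (y, x) \<in> E"
  "simple E \<Longrightarrow> (x, x) \<notin> E"
  by (auto simp: simple_def sym_def irrefl_def)

lemma simple_Restr: "simple E \<Longrightarrow> simple (E \<inter> W \<times> W)"
  by (auto simp: simple_def sym_def irrefl_def)

lemma simple_clique: "finite X \<Longrightarrow> simple (clique X)"
  by (simp add: simple_def finite_clique) (auto simp: sym_def irrefl_def clique_def)

lemma aor_Restr:
  assumes "T \<in> aor E"
  shows "T \<inter> W \<times> W \<in> aor (E \<inter> W \<times> W)"
  using assms acyclic_subset[of T "T \<inter> W \<times> W"] by (auto simp: aor_def)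

text \<open>The inclusion in \<open>meet\<close> also admits disjoint vertex sets, with an arbitrary
  \<open>c\<close>, so disjoint unions are one-sums too.\<close>

locale one_sum =
  fixes E1 E2 :: "'a rel" and V1 V2 :: "'a set" and c :: 'a
  assumes simple: "simple E1" "simple E2"
    and sub: "E1 \<subseteq> V1 \<times> V1" "E2 \<subseteq> V2 \<times> V2"
    and meet: "V1 \<inter> V2 \<subseteq> {c}"
begin

lemma disj: "E1 \<inter> E2 = {}"
proof (rule ccontr)
  assume "E1 \<inter> E2 \<noteq> {}"
  then obtain x y where xy: "(x, y) \<in> E1" "(x, y) \<in> E2" by auto
  then have "x = c" "y = c" using sub meet by blast+
  then show False using xy(1) simpleD(3)[OF simple(1)] by blast
qed

lemma simple_Un: "simple (E1 \<union> E2)"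
  using simple by (auto simp: simple_def sym_def irrefl_def)

lemma rev_disj: "(x, y) \<in> E1 \<Longrightarrow> (y, x) \<notin> E2" "(x, y) \<in> E2 \<Longrightarrow> (y, x) \<notin> E1"
  using disj simple by (auto dest: simpleD(2))

lemma aor_Un:
  assumes R1: "R1 \<in> aor E1" and R2: "R2 \<in> aor E2"
  shows "R1 \<union> R2 \<in> aor (E1 \<union> E2)"
proof -
  note s = aor_sub[OF R1] aor_sub[OF R2]
  have "finite R1" "finite R2"
    using finite_subset[OF s(1)] finite_subset[OF s(2)] simple[THEN simpleD(1)] by simp_all
  then obtain f g :: "'a \<Rightarrow> int" where f: "\<And>x y. (x, y) \<in> R1 \<Longrightarrow> f x < f y"
    and g: "\<And>x y. (x, y) \<in> R2 \<Longrightarrow> g x < g y"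
    using ex_rank_if_acyclic[OF _ aor_acyclic[OF R1]] ex_rank_if_acyclic[OF _ aor_acyclic[OF R2]]
    by metis
  \<comment> \<open>Both potentials are normalised to vanish at \<open>c\<close>, the only possible
    common vertex, so they glue.\<close>
  define h where "h x = (if x \<in> V1 then f x - f c else g x - g c)" for x
  have h2: "h x = g x - g c" if "x \<in> V2" for x
    using meet that by (auto simp: h_def)
  have "acyclic (R1 \<union> R2)"
  proof (rule acyclic_if_rank[of _ h])
    fix x y assume "(x, y) \<in> R1 \<union> R2"
    then show "h x < h y"
    proof
      assume "(x, y) \<in> R1"
      then show ?thesis using s sub f by (fastforce simp: h_def)
    next
      assume xy: "(x, y) \<in> R2"
      then have "x \<in> V2" "y \<in> V2" using s sub by auto
      then show ?thesis using g[OF xy] h2 by simp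
    qed
  qed
  moreover have "(u, v) \<in> R1 \<union> R2 \<longleftrightarrow> (v, u) \<notin> R1 \<union> R2" if "(u, v) \<in> E1 \<union> E2" for u v
    using that
  proof
    assume uv: "(u, v) \<in> E1"
    then have "(u, v) \<notin> R2" "(v, u) \<notin> R2" using s disj rev_disj by auto
    then show ?thesis using aor_iff[OF R1 uv] by auto
  next
    assume uv: "(u, v) \<in> E2"
    then have "(u, v) \<notin> R1" "(v, u) \<notin> R1" using s disj rev_disj by auto
    then show ?thesis using aor_iff[OF R2 uv] by auto
  qed
  ultimately show ?thesis using s by (auto simp: aor_def)
qed

lemma aor_Int:
  assumes "R \<in> aor (E1 \<union> E2)"
  shows "R \<inter> E1 \<in> aor E1" "R \<inter> E2 \<in> aor E2"
  using assms acyclic_subset[of R "R \<inter> E1"] acyclic_subset[of R "R \<inter> E2"] simple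
  by (auto simp: aor_def dest: simpleD(2))

lemma aor_Un_split: "R \<in> aor (E1 \<union> E2) \<Longrightarrow> (R \<inter> E1) \<union> (R \<inter> E2) = R"
  by (auto simp: aor_def)

lemma Un_Int_left:
  assumes "A \<subseteq> E1" "B \<subseteq> E2"
  shows "(A \<union> B) \<inter> E1 = A" "(A \<union> B) \<inter> E2 = B"
  using assms disj by auto

lemma card_ext_Un:
  assumes "P1 \<subseteq> E1" "P2 \<subseteq> E2"
  shows "card (aor_ext (E1 \<union> E2) (P1 \<union> P2)) = card (aor_ext E1 P1) * card (aor_ext E2 P2)"
proof -
  have "bij_betw (\<lambda>(A, B). A \<union> B) (aor_ext E1 P1 \<times> aor_ext E2 P2) (aor_ext (E1 \<union> E2) (P1 \<union> P2))"
  proof (rule bij_betw_byWitness[where f' = "\<lambda>T. (T \<inter> E1, T \<inter> E2)"])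
    show "\<forall>z \<in> aor_ext E1 P1 \<times> aor_ext E2 P2. (\<lambda>T. (T \<inter> E1, T \<inter> E2)) (case z of (A, B) \<Rightarrow> A \<union> B) = z"
    proof
      fix z assume "z \<in> aor_ext E1 P1 \<times> aor_ext E2 P2"
      then obtain A B where "z = (A, B)" "A \<subseteq> E1" "B \<subseteq> E2"
        by (cases z) (simp add: aor_ext_def aor_def)
      then show "(\<lambda>T. (T \<inter> E1, T \<inter> E2)) (case z of (A, B) \<Rightarrow> A \<union> B) = z"
        using Un_Int_left by simp
    qed
    show "\<forall>T \<in> aor_ext (E1 \<union> E2) (P1 \<union> P2). (case (T \<inter> E1, T \<inter> E2) of (A, B) \<Rightarrow> A \<union> B) = T"
      using aor_Un_split by (simp add: aor_ext_def)
    show "(\<lambda>(A, B). A \<union> B) ` (aor_ext E1 P1 \<times> aor_ext E2 P2) \<subseteq> aor_ext (E1 \<union> E2) (P1 \<union> P2)"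
      by (auto simp: aor_ext_def intro!: aor_Un)
    show "(\<lambda>T. (T \<inter> E1, T \<inter> E2)) ` aor_ext (E1 \<union> E2) (P1 \<union> P2) \<subseteq> aor_ext E1 P1 \<times> aor_ext E2 P2"
      using aor_Int assms unfolding aor_ext_def by blast
  qed
  from bij_betw_same_card[OF this] show ?thesis by (simp add: card_cartesian_product)
qed

text \<open>Interval sizes multiply over the two parts, so the two inequalities may be
  multiplied.\<close>

lemma hull_ineq_Un:
  assumes h1: "hull_ineq E1" and h2: "hull_ineq E2"
  shows "hull_ineq (E1 \<union> E2)"
  unfolding hull_ineq_def
proof (intro ballI)
  fix R S T assume *: "R \<in> aor (E1 \<union> E2)" "S \<in> aor (E1 \<union> E2)" "T \<in> aor (E1 \<union> E2)"
  have eq: "card (aor_ext (E1 \<union> E2) (A \<inter> B)) = card (aor_ext E1 ((A \<inter> E1) \<inter> (B \<inter> E1))) *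
      card (aor_ext E2 ((A \<inter> E2) \<inter> (B \<inter> E2)))" if "A \<in> aor (E1 \<union> E2)" for A B
  proof -
    have "A \<inter> B = ((A \<inter> E1) \<inter> (B \<inter> E1)) \<union> ((A \<inter> E2) \<inter> (B \<inter> E2))"
      using aor_sub[OF that] by auto
    then show ?thesis
      using card_ext_Un[of "(A \<inter> E1) \<inter> (B \<inter> E1)" "(A \<inter> E2) \<inter> (B \<inter> E2)"] by auto
  qed
  let ?c1 = "\<lambda>A B. card (aor_ext E1 ((A \<inter> E1) \<inter> (B \<inter> E1)))"
  let ?c2 = "\<lambda>A B. card (aor_ext E2 ((A \<inter> E2) \<inter> (B \<inter> E2)))"
  have "?c1 R T \<le> ?c1 R S * ?c1 S T" "?c2 R T \<le> ?c2 R S * ?c2 S T"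
    using h1 h2 aor_Int * unfolding hull_ineq_def by meson+
  then have "?c1 R T * ?c2 R T \<le> (?c1 R S * ?c1 S T) * (?c2 R S * ?c2 S T)"
    by (rule mult_le_mono)
  then show "card (aor_ext (E1 \<union> E2) (R \<inter> T)) \<le>
      card (aor_ext (E1 \<union> E2) (R \<inter> S)) * card (aor_ext (E1 \<union> E2) (S \<inter> T))"
    using eq * by (simp add: ac_simps)
qed

end

text \<open>
  The orientations of the subgraph induced by \<open>W\<close> embed as a convex set: direct the remaining edges
  along a linear order in which \<open>W\<close> comes first.
\<close>

lemma ex_frame:
  assumes E: "simple E"
  obtains F where "F \<subseteq> E" "F \<inter> W \<times> W = {}"
    "\<And>T. T \<subseteq> W \<times> W \<Longrightarrow> T \<union> F \<in> aor E \<longleftrightarrow> T \<in> aor (E \<inter> W \<times> W)"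
proof -
  have finF: "finite (Field E)" using simpleD(1)[OF E] by (simp add: finite_Field)
  then obtain g :: "'a \<Rightarrow> nat" where g: "inj_on g (Field E)"
    using finite_imp_inj_to_nat_seg by metis
  \<comment> \<open>Edges leaving \<open>W\<close> point outwards; edges disjoint from
    \<open>W\<close> follow the injective numbering \<open>g\<close>.\<close>
  define F where "F = {(x, y) \<in> E. y \<notin> W \<and> (x \<in> W \<or> g x < g y)}"
  have "T \<union> F \<in> aor E" if T: "T \<in> aor (E \<inter> W \<times> W)" for T
  proof -
    have Ts: "T \<subseteq> E \<inter> W \<times> W" using aor_sub[OF T] .
    then have "finite T" using simpleD(1)[OF E] finite_subset[of T E] by auto
    then obtain f :: "'a \<Rightarrow> int" where f: "\<And>x y. (x, y) \<in> T \<Longrightarrow> f x < f y"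
      using ex_rank_if_acyclic[OF _ aor_acyclic[OF T]] by metis
    \<comment> \<open>\<open>M\<close> exceeds every value of \<open>f\<close> on the field, so the
      outside vertices rank above all of \<open>W\<close>. Inserting 0 keeps the set nonempty when
      there are no edges.\<close>
    define M where "M = Max (insert 0 (f ` Field E)) + 1"
    have M: "f x < M" if "x \<in> Field E" for x
      using that finF Max_ge[of "insert 0 (f ` Field E)" "f x"] by (auto simp: M_def)
    define h where "h x = (if x \<in> W then f x else M + int (g x))" for x
    have "acyclic (T \<union> F)"
    proof (rule acyclic_if_rank[of _ h])
      fix x y assume "(x, y) \<in> T \<union> F"
      then show "h x < h y"
      proof
        assume "(x, y) \<in> T"
        then show ?thesis using Ts f by (auto simp: h_def)
      next
        assume xy: "(x, y) \<in> F"
        then have "x \<in> Field E" by (auto simp: F_def Field_def)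
        then show ?thesis using xy M[of x] by (auto simp: h_def F_def)
      qed
    qed
    moreover have "(u, v) \<in> T \<union> F \<longleftrightarrow> (v, u) \<notin> T \<union> F" if uv: "(u, v) \<in> E" for u v
    proof (cases "u \<in> W \<and> v \<in> W")
      case True
      then have "(u, v) \<notin> F" "(v, u) \<notin> F" by (auto simp: F_def)
      then show ?thesis using aor_iff[OF T, of u v] uv True by auto
    next
      case False
      have "u \<noteq> v" using uv simpleD(3)[OF E] by auto
      moreover have "u \<in> Field E" "v \<in> Field E" using uv by (auto simp: Field_def)
      ultimately have "g u \<noteq> g v" using g by (auto dest: inj_onD)
      then show ?thesis using False uv simpleD(2)[OF E uv] Ts by (auto simp: F_def)
    qed
    ultimately show ?thesis using Ts by (auto simp: aor_def F_def)
  qed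
  moreover have "T \<in> aor (E \<inter> W \<times> W)" if T: "T \<union> F \<in> aor E" "T \<subseteq> W \<times> W" for T
  proof -
    have "(T \<union> F) \<inter> W \<times> W = T" using T(2) by (auto simp: F_def)
    then show ?thesis using aor_Restr[OF T(1), of W] by simp
  qed
  ultimately show ?thesis
    using that[of F] by (auto simp: F_def)
qed

text \<open>All embedded orientations share \<open>F\<close>, which already holds one arc of every
  edge not inside \<open>W\<close>. An orientation between two of them contains \<open>F\<close> and
  so varies only inside \<open>W\<close>: intervals of the subgraph and of \<open>E\<close>
  correspond under \<open>T \<union> F\<close>.\<close>

lemma hull_ineq_Restr:
  assumes E: "simple E" and h: "hull_ineq E"
  shows "hull_ineq (E \<inter> W \<times> W)"
proof -
  obtain F where F: "F \<subseteq> E" "F \<inter> W \<times> W = {}"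
    "\<And>T. T \<subseteq> W \<times> W \<Longrightarrow> T \<union> F \<in> aor E \<longleftrightarrow> T \<in> aor (E \<inter> W \<times> W)"
    using ex_frame[OF E] by metis
  have inW: "T \<subseteq> W \<times> W" if "T \<in> aor (E \<inter> W \<times> W)" for T
    using aor_sub[OF that] by auto
  have eq: "card (aor_ext E ((A \<union> F) \<inter> (B \<union> F))) = card (aor_ext (E \<inter> W \<times> W) (A \<inter> B))"
    if A: "A \<in> aor (E \<inter> W \<times> W)" and B: "B \<in> aor (E \<inter> W \<times> W)" for A B
  proof -
    have "aor_ext E ((A \<union> F) \<inter> (B \<union> F)) = (\<lambda>T. T \<union> F) ` aor_ext (E \<inter> W \<times> W) (A \<inter> B)"
    proof (intro equalityI subsetI)
      fix T assume "T \<in> aor_ext E ((A \<union> F) \<inter> (B \<union> F))"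
      then have T: "T \<in> aor E" "A \<inter> B \<subseteq> T" "F \<subseteq> T" by (auto simp: aor_ext_def)
      have AF: "A \<union> F \<in> aor E" using A F(3) inW by blast
      have "(x, y) \<in> F" if xy: "(x, y) \<in> T" "\<not> (x \<in> W \<and> y \<in> W)" for x y
      proof -
        have e: "(x, y) \<in> E" "(y, x) \<in> E" using xy(1) aor_sub[OF T(1)] simpleD(2)[OF E] by auto
        have "(y, x) \<notin> A \<union> F" using xy T(3) inW[OF A] aor_asym[OF T(1), of x y] by auto
        then have "(x, y) \<in> A \<union> F" using aor_iff[OF AF e(2)] by auto
        then show ?thesis using xy(2) inW[OF A] by auto
      qed
      then have "T = (T \<inter> W \<times> W) \<union> F" using T(3) by auto
      moreover have "T \<inter> W \<times> W \<in> aor_ext (E \<inter> W \<times> W) (A \<inter> B)"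
        using aor_Restr[OF T(1)] T(2) inW[OF A] by (auto simp: aor_ext_def)
      ultimately show "T \<in> (\<lambda>T. T \<union> F) ` aor_ext (E \<inter> W \<times> W) (A \<inter> B)" by blast
    next
      fix T assume "T \<in> (\<lambda>T. T \<union> F) ` aor_ext (E \<inter> W \<times> W) (A \<inter> B)"
      then show "T \<in> aor_ext E ((A \<union> F) \<inter> (B \<union> F))"
        using F(3) inW by (auto simp: aor_ext_def)
    qed
    moreover have "inj_on (\<lambda>T. T \<union> F) (aor_ext (E \<inter> W \<times> W) (A \<inter> B))"
    proof (rule inj_onI)
      fix S T assume "S \<in> aor_ext (E \<inter> W \<times> W) (A \<inter> B)" "T \<in> aor_ext (E \<inter> W \<times> W) (A \<inter> B)" "S \<union> F = T \<union> F"
      then show "S = T" using inW[of S] inW[of T] F(2) unfolding aor_ext_def by blast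
    qed
    ultimately show ?thesis by (simp add: card_image)
  qed
  show ?thesis
    unfolding hull_ineq_def
  proof (intro ballI)
    fix R S T assume *: "R \<in> aor (E \<inter> W \<times> W)" "S \<in> aor (E \<inter> W \<times> W)" "T \<in> aor (E \<inter> W \<times> W)"
    then have "R \<union> F \<in> aor E" "S \<union> F \<in> aor E" "T \<union> F \<in> aor E" using F(3) inW by blast+
    then have "card (aor_ext E ((R \<union> F) \<inter> (T \<union> F))) \<le>
        card (aor_ext E ((R \<union> F) \<inter> (S \<union> F))) * card (aor_ext E ((S \<union> F) \<inter> (T \<union> F)))"
      using h unfolding hull_ineq_def by blast
    then show "card (aor_ext (E \<inter> W \<times> W) (R \<inter> T)) \<le>
        card (aor_ext (E \<inter> W \<times> W) (R \<inter> S)) * card (aor_ext (E \<inter> W \<times> W) (S \<inter> T))"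
      using eq * by simp
  qed
qed

section \<open>Injective relabelling of vertices\<close>

lemma inj_on_map_prod_image:
  assumes "inj_on f V"
  shows "inj_on (map_prod f f) (V \<times> V)"
  using assms by (auto simp: inj_on_def)

lemma map_prod_image_iff:
  assumes "inj_on f V" "R \<subseteq> V \<times> V" "x \<in> V" "y \<in> V"
  shows "(f x, f y) \<in> map_prod f f ` R \<longleftrightarrow> (x, y) \<in> R"
  using inj_on_image_mem_iff[OF inj_on_map_prod_image[OF assms(1)], of "(x, y)" R] assms by auto

lemma ball_map_prod:
  "(\<forall>(u, v) \<in> map_prod f f ` E. Q u v) \<longleftrightarrow> (\<forall>(u, v) \<in> E. Q (f u) (f v))"
  by (simp add: case_prod_beta map_prod_def)

text \<open>Acyclicity is moved in both directions by transporting potentials, along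
  \<open>f\<close> one way and along its inverse on \<open>V\<close> the other way.\<close>

lemma aor_relabel:
  assumes f: "inj_on f V" and E: "finite E" "E \<subseteq> V \<times> V"
  shows "aor (map_prod f f ` E) = (`) (map_prod f f) ` aor E"
proof -
  let ?f = "map_prod f f"
  have iff: "?f ` R \<in> aor (?f ` E) \<longleftrightarrow> R \<in> aor E" if R: "R \<subseteq> E" for R
  proof -
    have RV: "R \<subseteq> V \<times> V" using R E by auto
    have "acyclic (?f ` R) \<longleftrightarrow> acyclic R"
    proof
      assume "acyclic (?f ` R)"
      then obtain r :: "'b \<Rightarrow> int" where r: "\<And>x y. (x, y) \<in> ?f ` R \<Longrightarrow> r x < r y"
        using ex_rank_if_acyclic[of "?f ` R"] finite_subset[OF R E(1)] by blast
      show "acyclic R"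
        by (rule acyclic_if_rank[of _ "\<lambda>x. r (f x)"]) (use r in force)
    next
      assume "acyclic R"
      then obtain r :: "'a \<Rightarrow> int" where r: "\<And>x y. (x, y) \<in> R \<Longrightarrow> r x < r y"
        using ex_rank_if_acyclic[of R] finite_subset[OF R E(1)] by blast
      show "acyclic (?f ` R)"
      proof (rule acyclic_if_rank[of _ "\<lambda>z. r (the_inv_into V f z)"])
        fix x y assume "(x, y) \<in> ?f ` R"
        then obtain a b where ab: "(a, b) \<in> R" "x = f a" "y = f b" by auto
        then have "a \<in> V" "b \<in> V" using RV by auto
        then show "r (the_inv_into V f x) < r (the_inv_into V f y)"
          using ab r the_inv_into_f_f[OF f] by simp
      qed
    qed
    moreover have "(\<forall>(u, v) \<in> ?f ` E. (u, v) \<in> ?f ` R \<longleftrightarrow> (v, u) \<notin> ?f ` R) \<longleftrightarrow>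
        (\<forall>(u, v) \<in> E. (u, v) \<in> R \<longleftrightarrow> (v, u) \<notin> R)"
    proof -
      have "(f u, f v) \<in> ?f ` R \<longleftrightarrow> (u, v) \<in> R" "(f v, f u) \<in> ?f ` R \<longleftrightarrow> (v, u) \<in> R"
        if "(u, v) \<in> E" for u v
        using that E(2) by (auto simp only: intro!: map_prod_image_iff[OF f RV])
      then have "((f u, f v) \<in> ?f ` R \<longleftrightarrow> (f v, f u) \<notin> ?f ` R) \<longleftrightarrow>
          ((u, v) \<in> R \<longleftrightarrow> (v, u) \<notin> R)" if "(u, v) \<in> E" for u v
        using that by simp
      then show ?thesis unfolding ball_map_prod
        by (intro ball_cong refl) (simp only: split_paired_all case_prod_conv)
    qed
    moreover have "?f ` R \<subseteq> ?f ` E" using R by auto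
    ultimately show ?thesis using R by (simp add: aor_def)
  qed
  show ?thesis
  proof (intro equalityI subsetI)
    fix S assume S: "S \<in> aor (?f ` E)"
    then obtain R where "R \<subseteq> E" "S = ?f ` R" using aor_sub by (meson subset_image_iff)
    then show "S \<in> (`) ?f ` aor E" using iff S by auto
  qed (use iff aor_sub in auto)
qed

lemma hull_ineq_relabel:
  assumes f: "inj_on f V" and E: "finite E" "E \<subseteq> V \<times> V"
    and h: "hull_ineq (map_prod f f ` E)"
  shows "hull_ineq E"
proof -
  let ?f = "map_prod f f"
  have inj: "inj_on ?f E" using inj_on_map_prod_image[OF f] E(2) by (rule inj_on_subset)
  have eq: "card (aor_ext (?f ` E) (?f ` A \<inter> ?f ` B)) = card (aor_ext E (A \<inter> B))"
    if "A \<in> aor E" "B \<in> aor E" for A B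
  proof -
    have s: "A \<subseteq> E" "B \<subseteq> E" using that by (auto dest: aor_sub)
    have im: "?f ` A \<inter> ?f ` B = ?f ` (A \<inter> B)"
      using inj_on_image_Int[OF inj s] by simp
    have "aor_ext (?f ` E) (?f ` (A \<inter> B)) = (`) ?f ` aor_ext E (A \<inter> B)"
    proof -
      have "?f ` (A \<inter> B) \<subseteq> ?f ` T \<longleftrightarrow> A \<inter> B \<subseteq> T" if "T \<in> aor E" for T
      proof
        assume *: "?f ` (A \<inter> B) \<subseteq> ?f ` T"
        show "A \<inter> B \<subseteq> T"
        proof
          fix z assume z: "z \<in> A \<inter> B"
          then have zE: "z \<in> E" and fz: "?f z \<in> ?f ` T" using * s by blast+
          then show "z \<in> T" using inj_on_image_mem_iff[OF inj zE aor_sub[OF that]] by metis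
        qed
      qed (rule image_mono)
      then show ?thesis unfolding aor_ext_def aor_relabel[OF f E] by auto
    qed
    moreover have "inj_on ((`) ?f) (aor_ext E (A \<inter> B))"
      using inj_on_image_Pow[OF inj] by (rule inj_on_subset) (auto simp: aor_ext_def aor_def)
    ultimately show ?thesis using im by (simp add: card_image)
  qed
  show ?thesis
    unfolding hull_ineq_def
  proof (intro ballI)
    fix R S T assume *: "R \<in> aor E" "S \<in> aor E" "T \<in> aor E"
    then have "?f ` R \<in> aor (?f ` E)" "?f ` S \<in> aor (?f ` E)" "?f ` T \<in> aor (?f ` E)"
      by (auto simp: aor_relabel[OF f E])
    then have "card (aor_ext (?f ` E) (?f ` R \<inter> ?f ` T)) \<le>
        card (aor_ext (?f ` E) (?f ` R \<inter> ?f ` S)) * card (aor_ext (?f ` E) (?f ` S \<inter> ?f ` T))"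
      using h unfolding hull_ineq_def by blast
    then show "card (aor_ext E (R \<inter> T)) \<le> card (aor_ext E (R \<inter> S)) * card (aor_ext E (S \<inter> T))"
      using eq * by simp
  qed
qed

section \<open>The metric on acyclic orientations\<close>

definition aor_graph :: "'a rel \<Rightarrow> 'a rel pair_pre_digraph" where
  "aor_graph E = \<lparr> pverts = aor E, parcs = {(R, S). R \<in> aor E \<and> S \<in> aor E \<and> card (R - S) = 1} \<rparr>"

lemma pverts_aor_graph [simp]: "pverts (aor_graph E) = aor E"
  by (simp add: aor_graph_def)

lemma simple_parcs: "pair_graph G \<Longrightarrow> simple (parcs G)"
proof -
  assume "pair_graph G"
  then interpret pair_graph G .
  show ?thesis
    using pair_finite_arcs pair_sym_arcs pair_no_loops
    by (simp add: simple_def symmetric_def) (force simp: irrefl_def)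
qed

text \<open>Each edge of disagreement contributes exactly one arc to \<open>R - S\<close>, namely
  the one chosen by \<open>R\<close>.\<close>

lemma card_diff_edges:
  assumes "simple (parcs G)" "R \<in> aor (parcs G)" "S \<in> aor (parcs G)"
  shows "card (diff_edges G R S) = card (R - S)"
proof -
  let ?f = "\<lambda>(u, v). {u, v}"
  have RE: "R \<subseteq> parcs G" using aor_sub[OF assms(2)] .
  have flip: "(v, u) \<in> R - S" if "(u, v) \<in> parcs G" "(u, v) \<notin> R" "(u, v) \<in> S" for u v
    using that aor_iff[OF assms(2) that(1)] aor_asym[OF assms(3)] by auto
  have "?f ` (R - S) = diff_edges G R S"
  proof (intro equalityI subsetI)
    fix e assume "e \<in> ?f ` (R - S)"
    then show "e \<in> diff_edges G R S" using RE by (force simp: diff_edges_def)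
  next
    fix e assume "e \<in> diff_edges G R S"
    then obtain u v where e: "e = {u, v}" "(u, v) \<in> parcs G" "\<not> ((u, v) \<in> R \<longleftrightarrow> (u, v) \<in> S)"
      by (auto simp: diff_edges_def)
    then consider "(u, v) \<in> R - S" | "(v, u) \<in> R - S" using flip by blast
    then show "e \<in> ?f ` (R - S)"
      by cases (use e(1) in \<open>force simp: insert_commute\<close>)+
  qed
  moreover have "inj_on ?f (R - S)"
    using aor_asym[OF assms(2)] by (auto simp: inj_on_def doubleton_eq_iff)
  ultimately show ?thesis by (metis card_image)
qed

lemma ac_eq_aor_graph:
  assumes "simple (parcs G)"
  shows "ac G = aor_graph (parcs G)"
proof -
  have "{R. orientation G R \<and> acyclic R} = aor (parcs G)"
    by (auto simp: aor_def orientation_def)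
  then show ?thesis
    using card_diff_edges[OF assms] by (auto simp: ac_def aor_graph_def Let_def)
qed

text \<open>A frame for the empty vertex set directs every edge, so it is an acyclic orientation
  itself.\<close>

lemma ex_aor:
  assumes "simple E"
  shows "\<exists>R. R \<in> aor E"
proof -
  obtain F where "\<And>T. T \<subseteq> {} \<times> {} \<Longrightarrow> T \<union> F \<in> aor E \<longleftrightarrow> T \<in> aor (E \<inter> {} \<times> {})"
    using ex_frame[OF assms, of "{}"] by metis
  from this[of "{}"] show ?thesis by (auto simp: aor_def acyclic_def)
qed

lemma aor_finite: "simple E \<Longrightarrow> R \<in> aor E \<Longrightarrow> finite R"
  using aor_sub simpleD(1) finite_subset by metis

lemma card_diff_triangle:
  assumes "simple E" "R \<in> aor E" "S \<in> aor E" "T \<in> aor E"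
  shows "card (R - S) \<le> card (R - T) + card (T - S)"
proof -
  have "card (R - S) \<le> card ((R - T) \<union> (T - S))"
    using assms aor_finite by (intro card_mono) auto
  also have "\<dots> \<le> card (R - T) + card (T - S)" by (rule card_Un_le)
  finally show ?thesis .
qed

text \<open>In general \<open>R - S\<close> lies in \<open>(R - T) \<union> (T - S)\<close>. An arc
  of \<open>R \<inter> S\<close> missing from \<open>T\<close> is counted on the larger side only,
  so it makes the triangle inequality strict. If there is none, an arc of \<open>T - S\<close> has
  its reverse in \<open>S\<close> but not in \<open>T\<close>, hence not in \<open>R\<close>, so it
  belongs to \<open>R\<close> and the union is exact and disjoint.\<close>

lemma between_iff:
  assumes E: "simple E" and R: "R \<in> aor E" and S: "S \<in> aor E" and T: "T \<in> aor E"
  shows "card (R - T) + card (T - S) = card (R - S) \<longleftrightarrow> R \<inter> S \<subseteq> T"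
proof -
  have fin: "finite R" "finite S" "finite T" using aor_finite E R S T by auto
  show ?thesis
  proof
    assume sub: "R \<inter> S \<subseteq> T"
    have "T - S \<subseteq> R"
    proof (rule subrelI)
      fix u v assume uv: "(u, v) \<in> T - S"
      then have e: "(u, v) \<in> E" using aor_sub[OF T] by auto
      have "(v, u) \<in> S" using aor_iff[OF S e] uv by auto
      then show "(u, v) \<in> R" using aor_iff[OF R e] sub uv aor_asym[OF T] by auto
    qed
    then have "R - S = (R - T) \<union> (T - S)" "(R - T) \<inter> (T - S) = {}" using sub by auto
    then show "card (R - T) + card (T - S) = card (R - S)"
      using fin by (simp add: card_Un_disjoint)
  next
    assume eq: "card (R - T) + card (T - S) = card (R - S)"
    show "R \<inter> S \<subseteq> T"
    proof (rule ccontr)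
      assume "\<not> R \<inter> S \<subseteq> T"
      then obtain e where e: "e \<in> R" "e \<in> S" "e \<notin> T" by auto
      have "card (R - S) \<le> card ((R - T - {e}) \<union> (T - S))"
        using fin e by (intro card_mono) auto
      also have "\<dots> \<le> card (R - T - {e}) + card (T - S)" by (rule card_Un_le)
      also have "card (R - T - {e}) < card (R - T)"
        using fin e by (intro card_Diff1_less) auto
      finally show False using eq by simp
    qed
  qed
qed

lemma rtrancl_leaves:
  assumes "(u, v) \<in> Q\<^sup>*"
  shows "(u, v) \<in> S\<^sup>* \<or> (\<exists>x y. (x, y) \<in> Q - S \<and> (u, x) \<in> Q\<^sup>* \<and> (y, v) \<in> Q\<^sup>*)"
  using assms
proof (induction rule: converse_rtrancl_induct)
  case base then show ?case by simp
next
  case (step x y)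
  then show ?case
    by (meson DiffI converse_rtrancl_into_rtrancl rtrancl.rtrancl_refl)
qed

text \<open>
  An arc of \<open>R - S\<close> spanning the fewest levels of \<open>R\<close> is flippable: a directed path of \<open>R\<close>
  shortcutting it would contain a shorter arc of \<open>R - S\<close>, or else close a cycle in \<open>S\<close>.
\<close>

lemma ex_flippable:
  assumes E: "simple E" and R: "R \<in> aor E" and S: "S \<in> aor E" and ne: "R \<noteq> S"
  obtains R' where "R' \<in> aor E" "card (R - R') = 1" "card (R - S) = Suc (card (R' - S))"
proof -
  obtain f :: "'a \<Rightarrow> int" where f: "\<And>x y. (x, y) \<in> R \<Longrightarrow> f x < f y"
    using ex_rank_if_acyclic[OF aor_finite[OF E R] aor_acyclic[OF R]] by metis
  have f': "f x \<le> f y" "x \<noteq> y \<Longrightarrow> f x < f y" if "(x, y) \<in> R\<^sup>*" for x y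
  proof -
    have "f x < f y" if "(x, y) \<in> R\<^sup>+" for x y
      using that by (induction rule: trancl_induct) (use f in fastforce)+
    then show "f x \<le> f y" "x \<noteq> y \<Longrightarrow> f x < f y" using that by (force simp: rtrancl_eq_or_trancl)+
  qed
  have "R - S \<noteq> {}" using ne aor_subset_eq[OF R S] by auto
  then obtain e0 where "e0 \<in> R - S" by auto
  then obtain e where e: "e \<in> R - S"
    and min: "\<And>e'. e' \<in> R - S \<Longrightarrow> nat (f (snd e) - f (fst e)) \<le> nat (f (snd e') - f (fst e'))"
    using ex_has_least_nat[of "\<lambda>e. e \<in> R - S" e0 "\<lambda>e. nat (f (snd e) - f (fst e))"] by auto
  obtain u v where uv: "e = (u, v)" by (cases e)
  define R' where "R' = insert (v, u) (R - {(u, v)})"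
  have uvE: "(u, v) \<in> E" and vuE: "(v, u) \<in> E" and vuR: "(v, u) \<notin> R" and vuS: "(v, u) \<in> S"
    using e uv aor_sub[OF R] aor_asym[OF R] aor_iff[OF S, of v u] simpleD(2)[OF E] by auto
  have "(u, v) \<notin> (R - {(u, v)})\<^sup>*"
  proof
    assume "(u, v) \<in> (R - {(u, v)})\<^sup>*"
    from rtrancl_leaves[OF this, of S] show False
    proof
      assume "(u, v) \<in> S\<^sup>*"
      then have "(v, v) \<in> S\<^sup>+" using vuS by (rule rtrancl_into_trancl2[rotated])
      then show False using aor_acyclic[OF S] by (auto simp: acyclic_def)
    next
      assume "\<exists>x y. (x, y) \<in> R - {(u, v)} - S \<and> (u, x) \<in> (R - {(u, v)})\<^sup>* \<and> (y, v) \<in> (R - {(u, v)})\<^sup>*"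
      then obtain x y where xy: "(x, y) \<in> R - S" "(x, y) \<noteq> (u, v)"
        and p: "(u, x) \<in> R\<^sup>*" "(y, v) \<in> R\<^sup>*"
        using rtrancl_mono[of "R - {(u, v)}" R] by blast
      \<comment> \<open>As \<open>(x, y)\<close> differs from the removed arc \<open>(u, v)\<close>,
        one of the two outer pieces of the path is nontrivial, and \<open>(x, y)\<close> spans
        strictly fewer levels. Its own span is positive, so truncation by \<open>nat\<close> does no
        harm.\<close>
      have "f u < f x \<or> f y < f v" using f'(2)[OF p(1)] f'(2)[OF p(2)] xy(2) by auto
      then have "f y - f x < f v - f u" using f'(1)[OF p(1)] f'(1)[OF p(2)] by linarith
      moreover have "f x < f y" using xy f by auto
      ultimately show False using min[OF xy(1)] uv by simp
    qed
  qed
  moreover have "acyclic (R - {(u, v)})" using aor_acyclic[OF R] by (rule acyclic_subset) auto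
  ultimately have "acyclic R'" by (simp add: R'_def acyclic_insert)
  moreover have "(a, b) \<in> R' \<longleftrightarrow> (b, a) \<notin> R'" if "(a, b) \<in> E" for a b
    using aor_iff[OF R that] e uv vuR simpleD(3)[OF E] uvE by (auto simp: R'_def)
  ultimately have "R' \<in> aor E" using aor_sub[OF R] vuE by (auto simp: aor_def R'_def)
  moreover have "R - R' = {(u, v)}" using e uv vuR by (auto simp: R'_def)
  moreover have "R - S = insert (u, v) (R' - S)" "(u, v) \<notin> R' - S"
    using e uv vuS vuR by (auto simp: R'_def)
  ultimately show ?thesis
    using that[of R'] aor_finite[OF E \<open>R' \<in> aor E\<close>] by simp
qed

lemma aor_graph_relpow_card_le:
  assumes E: "simple E"
  shows "(R, S) \<in> parcs (aor_graph E) ^^ n \<Longrightarrow> R \<in> aor E \<Longrightarrow> S \<in> aor E \<and> card (R - S) \<le> n"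
proof (induction n arbitrary: S)
  case (Suc n)
  then obtain T where T: "T \<in> aor E" "card (R - T) \<le> n" and TS: "(T, S) \<in> parcs (aor_graph E)"
    by auto
  then have "S \<in> aor E" "card (T - S) = 1" by (auto simp: aor_graph_def)
  then show ?case using card_diff_triangle[OF E Suc.prems(2) _ T(1), of S] T(2) by auto
qed simp

text \<open>Each flip towards \<open>S\<close> lowers the number of disagreements by one, so the
  bound given by the triangle inequality is attained.\<close>

lemma aor_graph_relpow_card:
  assumes E: "simple E"
  shows "R \<in> aor E \<Longrightarrow> S \<in> aor E \<Longrightarrow> (R, S) \<in> parcs (aor_graph E) ^^ card (R - S)"
proof (induction "card (R - S)" arbitrary: R)
  case 0
  then have "R \<subseteq> S" using aor_finite[OF E 0(2)] by auto
  then have "R = S" using aor_subset_eq 0 by blast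
  then show ?case by simp
next
  case (Suc n)
  then have "R \<noteq> S" by auto
  then obtain R' where R': "R' \<in> aor E" "card (R - R') = 1" "card (R - S) = Suc (card (R' - S))"
    using ex_flippable[OF E Suc.prems] by metis
  then have "(R', S) \<in> parcs (aor_graph E) ^^ card (R' - S)" using Suc by auto
  moreover have "(R, R') \<in> parcs (aor_graph E)" using R' Suc.prems by (auto simp: aor_graph_def)
  ultimately show ?case using R'(3) relpow_Suc_I2 by metis
qed

lemma pair_wf_aor_graph: "pair_wf_digraph (aor_graph E)"
  by unfold_locales (auto simp: aor_graph_def)

text \<open>Links walks, given as arc lists, with powers of the adjacency relation, on which the
  distance arguments run.\<close>

lemma awalk_relpow:
  assumes "pair_wf_digraph H"
  shows "pre_digraph.awalk (with_proj H) u p v \<Longrightarrow> (u, v) \<in> parcs H ^^ length p"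
    and "u \<in> pverts H \<Longrightarrow> (u, v) \<in> parcs H ^^ n \<Longrightarrow>
      \<exists>p. pre_digraph.awalk (with_proj H) u p v \<and> length p = n"
proof -
  interpret pair_wf_digraph H by fact
  show "awalk u p v \<Longrightarrow> (u, v) \<in> parcs H ^^ length p"
  proof (induction p arbitrary: u)
    case Nil
    then show ?case by (simp add: awalk_Nil_iff)
  next
    case (Cons e p)
    then have "e \<in> parcs H" "fst e = u" "awalk (snd e) p v" by (auto simp: awalk_Cons_iff)
    then have "(u, snd e) \<in> parcs H" "(snd e, v) \<in> parcs H ^^ length p"
      using Cons.IH by auto
    then show ?case using relpow_Suc_I2 by fastforce
  qed
  show "u \<in> pverts H \<Longrightarrow> (u, v) \<in> parcs H ^^ n \<Longrightarrow> \<exists>p. awalk u p v \<and> length p = n"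
  proof (induction n arbitrary: u)
    case 0
    then show ?case by (auto simp: awalk_Nil_iff)
  next
    case (Suc n)
    from Suc.prems(2) obtain w where w: "(u, w) \<in> parcs H" "(w, v) \<in> parcs H ^^ n"
      by (meson relpow_Suc_D2)
    then obtain p where p: "awalk w p v" "length p = n" using Suc.IH in_arcsD2 by blast
    then have "awalk u ((u, w) # p) v" using w Suc.prems by (simp add: awalk_Cons_iff)
    then show ?case using p(2) by (intro exI[of _ "(u, w) # p"]) simp
  qed
qed

lemma gdist_aor_graph:
  assumes E: "simple E" and R: "R \<in> aor E" and S: "S \<in> aor E"
  shows "gdist (aor_graph E) R S = ereal (card (R - S))"
proof -
  interpret pair_wf_digraph "aor_graph E" by (rule pair_wf_aor_graph)
  note walks = awalk_relpow[OF pair_wf_aor_graph]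
  have cost: "awalk_cost (\<lambda>_. 1) p = length p" for p :: "('a rel \<times> 'a rel) list"
    by (induction p) auto
  have "gdist (aor_graph E) R S = (INF p \<in> {p. awalk R p S}. ereal (length p))"
    by (simp add: gdist_def \<mu>_def cost)
  also have "\<dots> = ereal (card (R - S))"
  proof (rule antisym)
    have "R \<in> pverts (aor_graph E)" using R by (simp add: aor_graph_def)
    from walks(2)[OF this aor_graph_relpow_card[OF E R S]]
    obtain p where "awalk R p S" "length p = card (R - S)" by blast
    then show "(INF p \<in> {p. awalk R p S}. ereal (length p)) \<le> ereal (card (R - S))"
      by (intro INF_lower2[of p]) auto
    show "ereal (card (R - S)) \<le> (INF p \<in> {p. awalk R p S}. ereal (length p))"
    proof (rule INF_greatest)
      fix p assume "p \<in> {p. awalk R p S}"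
      then have "(R, S) \<in> parcs (aor_graph E) ^^ length p" using walks(1) by simp
      then show "ereal (card (R - S)) \<le> ereal (length p)"
        using aor_graph_relpow_card_le[OF E _ R] by simp
    qed
  qed
  finally show ?thesis .
qed

text \<open>The interval is already convex: an orientation between two members contains their
  intersection, which contains \<open>R \<inter> S\<close>. Every convex set holding
  \<open>R\<close> and \<open>S\<close> contains all that lies between them.\<close>

lemma geo_hull_aor_graph:
  assumes E: "simple E" and R: "R \<in> aor E" and S: "S \<in> aor E"
  shows "geo_hull (aor_graph E) {R, S} = aor_ext E (R \<inter> S)"
proof -
  have btw: "gdist (aor_graph E) A C + gdist (aor_graph E) C B = gdist (aor_graph E) A B \<longleftrightarrow> A \<inter> B \<subseteq> C"
    if "A \<in> aor E" "B \<in> aor E" "C \<in> aor E" for A B C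
    using between_iff[OF E that] that by (simp add: gdist_aor_graph[OF E] of_nat_add[symmetric] del: of_nat_add)
  have "geo_convex (aor_graph E) (aor_ext E (R \<inter> S))"
    unfolding geo_convex_def pverts_aor_graph using btw by (auto simp: aor_ext_def)
  moreover have "{R, S} \<subseteq> aor_ext E (R \<inter> S)" using R S by (auto simp: aor_ext_def)
  moreover have "aor_ext E (R \<inter> S) \<subseteq> C" if "geo_convex (aor_graph E) C" "{R, S} \<subseteq> C" for C
    using that btw[OF R S] unfolding geo_convex_def pverts_aor_graph by (auto simp: aor_ext_def)
  ultimately show ?thesis unfolding geo_hull_def by (intro equalityI Inter_lower Inter_greatest) auto
qed

lemma connected_aor_graph:
  assumes E: "simple E"
  shows "connected (with_proj (aor_graph E))"
proof -
  let ?H = "mk_symmetric (with_proj (aor_graph E))"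
  have pv: "pverts ?H = aor E" by (simp add: mk_symmetric_def aor_graph_def)
  have sub: "parcs (aor_graph E) \<subseteq> parcs ?H" by (force simp: mk_symmetric_def)
  have reach: "(R, S) \<in> rtrancl_on (aor E) (parcs ?H)" if "R \<in> aor E" "(R, S) \<in> parcs (aor_graph E) ^^ n" for R S n
    using that(2)
  proof (induction n arbitrary: S)
    case 0
    then show ?case using that(1) by simp
  next
    case (Suc n)
    then obtain T where T: "(R, T) \<in> rtrancl_on (aor E) (parcs ?H)" "(T, S) \<in> parcs (aor_graph E)"
      by auto
    moreover have "T \<in> aor E" "S \<in> aor E" using T(2) by (auto simp: aor_graph_def)
    ultimately show ?case using sub by (intro rtrancl_on_into_rtrancl_on[OF T(1)]) auto
  qed
  have "\<forall>R \<in> aor E. \<forall>S \<in> aor E. (R, S) \<in> rtrancl_on (aor E) (parcs ?H)"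
    using reach aor_graph_relpow_card[OF E] by blast
  moreover have "aor E \<noteq> {}" using ex_aor[OF E] by blast
  ultimately show ?thesis
    by (simp add: connected_def strongly_connected_def reachable_def pv)
qed

theorem hull_property_aor_graph:
  assumes "simple E"
  shows "hull_property (aor_graph E) \<longleftrightarrow> hull_ineq E"
  using connected_aor_graph[OF assms] geo_hull_aor_graph[OF assms]
  by (simp add: hull_property_def hull_ineq_def)

section \<open>Isomorphisms and transfer of the inequality\<close>

text \<open>An arc of a pair digraph is determined by its ends, so the vertex bijection fixes the
  arc map that \<open>digraph_iso\<close> asks for.\<close>

definition adj_iso :: "('a \<Rightarrow> 'b) \<Rightarrow> 'a pair_pre_digraph \<Rightarrow> 'b pair_pre_digraph \<Rightarrow> bool" where
  "adj_iso f G H \<longleftrightarrow> bij_betw f (pverts G) (pverts H) \<and>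
     (\<forall>u \<in> pverts G. \<forall>v \<in> pverts G. (f u, f v) \<in> parcs H \<longleftrightarrow> (u, v) \<in> parcs G)"

lemma adj_iso_comp: "adj_iso f G H \<Longrightarrow> adj_iso g H K \<Longrightarrow> adj_iso (g \<circ> f) G K"
  unfolding adj_iso_def by (auto intro: bij_betw_trans dest: bij_betwE)

lemma adj_iso_inv:
  assumes "adj_iso f G H"
  shows "adj_iso (the_inv_into (pverts G) f) H G"
proof -
  have b: "bij_betw f (pverts G) (pverts H)" using assms by (simp add: adj_iso_def)
  have "(the_inv_into (pverts G) f u, the_inv_into (pverts G) f v) \<in> parcs G \<longleftrightarrow> (u, v) \<in> parcs H"
    if "u \<in> pverts H" "v \<in> pverts H" for u v
    using that assms b f_the_inv_into_f_bij_betw[OF b] bij_betwE[OF bij_betw_the_inv_into[OF b]]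
    unfolding adj_iso_def by metis
  then show ?thesis using bij_betw_the_inv_into[OF b] by (simp add: adj_iso_def)
qed

lemma digraph_iso_iff_adj_iso:
  assumes G: "pair_wf_digraph G" and H: "pair_wf_digraph H"
  shows "digraph_iso (with_proj G) (with_proj H) \<longleftrightarrow> (\<exists>f. adj_iso f G H)"
proof
  interpret G: pair_wf_digraph G by fact
  interpret H: pair_wf_digraph H by fact
  {
    assume "digraph_iso (with_proj G) (with_proj H)"
    then obtain h where h: "pre_digraph.digraph_isomorphism (with_proj G) h" "with_proj H = app_iso h (with_proj G)"
      unfolding digraph_iso_def by auto
    define f where "f = iso_verts h"
    have inj: "inj_on f (pverts G)" using h(1) by (simp add: G.digraph_isomorphism_def f_def)
    \<comment> \<open>The target of \<open>app_iso h\<close> has \<open>iso_tail h\<close> and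
      \<open>iso_head h\<close> as its incidence maps. Equality with \<open>with_proj H\<close>
      makes them the projections, whence \<open>iso_arcs h\<close> acts as \<open>f\<close> on both
      ends.\<close>
    have eq: "verts (with_proj H) = verts (app_iso h (with_proj G))"
      "arcs (with_proj H) = arcs (app_iso h (with_proj G))"
      "tail (with_proj H) = tail (app_iso h (with_proj G))"
      "head (with_proj H) = head (app_iso h (with_proj G))" using h(2) by simp_all
    then have HV: "pverts H = f ` pverts G" and HA: "parcs H = iso_arcs h ` parcs G"
      and ht: "iso_tail h = fst" "iso_head h = snd"
      by (simp_all add: f_def)
    have ia: "iso_arcs h a = (f (fst a), f (snd a))" if "a \<in> parcs G" for a
      using that h(1) ht by (simp add: G.digraph_isomorphism_def f_def prod_eq_iff)
    have "(f u, f v) \<in> parcs H \<longleftrightarrow> (u, v) \<in> parcs G" if uv: "u \<in> pverts G" "v \<in> pverts G" for u v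
    proof
      assume "(f u, f v) \<in> parcs H"
      then obtain a where a: "a \<in> parcs G" "f u = f (fst a)" "f v = f (snd a)" using HA ia by auto
      then have "u = fst a" "v = snd a"
        using inj uv G.arc_fst_in_verts[OF a(1)] G.arc_snd_in_verts[OF a(1)] by (auto dest: inj_onD)
      then show "(u, v) \<in> parcs G" using a(1) by simp
    next
      assume "(u, v) \<in> parcs G"
      then show "(f u, f v) \<in> parcs H" using HA ia[of "(u, v)"] by (metis fst_conv snd_conv imageI)
    qed
    then have "adj_iso f G H" using inj HV by (simp add: adj_iso_def bij_betw_def)
    then show "\<exists>f. adj_iso f G H" by blast
  }
  assume "\<exists>f. adj_iso f G H"
  then obtain f where f: "adj_iso f G H" by blast
  then have b: "bij_betw f (pverts G) (pverts H)" by (simp add: adj_iso_def)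
  then have inj: "inj_on f (pverts G)" by (rule bij_betw_imp_inj_on)
  define h where "h = \<lparr> iso_verts = f, iso_arcs = map_prod f f, iso_head = snd, iso_tail = fst \<rparr>"
  have sub: "parcs G \<subseteq> pverts G \<times> pverts G" "parcs H \<subseteq> pverts H \<times> pverts H"
    using G.in_arcsD1 G.in_arcsD2 H.in_arcsD1 H.in_arcsD2 by auto
  have "inj_on (map_prod f f) (parcs G)"
    using inj_on_map_prod_image[OF inj] sub(1) by (rule inj_on_subset)
  then have "G.digraph_isomorphism h"
    using inj G.wf_digraph_axioms by (auto simp: G.digraph_isomorphism_def h_def)
  moreover have "parcs H = map_prod f f ` parcs G"
  proof (intro equalityI subrelI)
    fix x y assume xy: "(x, y) \<in> parcs H"
    then obtain u v where "u \<in> pverts G" "v \<in> pverts G" "x = f u" "y = f v"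
      using sub(2) bij_betw_imp_surj_on[OF b] by blast
    then show "(x, y) \<in> map_prod f f ` parcs G" using f xy by (force simp: adj_iso_def)
  next
    fix x y assume "(x, y) \<in> map_prod f f ` parcs G"
    then obtain u v where "(u, v) \<in> parcs G" "x = f u" "y = f v" by auto
    then show "(x, y) \<in> parcs H" using f sub(1) unfolding adj_iso_def by blast
  qed
  then have "with_proj H = app_iso h (with_proj G)"
    using bij_betw_imp_surj_on[OF b] by (simp add: with_proj_def app_iso_def h_def)
  ultimately show "digraph_iso (with_proj G) (with_proj H)" unfolding digraph_iso_def by blast
qed

lemma adj_iso_relpow:
  assumes f: "adj_iso f G H" and wf: "pair_wf_digraph G"
  shows "(u, v) \<in> parcs G ^^ n \<Longrightarrow> u \<in> pverts G \<Longrightarrow> v \<in> pverts G \<and> (f u, f v) \<in> parcs H ^^ n"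
proof (induction n arbitrary: v)
  case (Suc n)
  then obtain w where w: "w \<in> pverts G" "(f u, f w) \<in> parcs H ^^ n" "(w, v) \<in> parcs G" by auto
  then have "v \<in> pverts G" using wf by (auto dest: pair_wf_digraph.in_arcsD2)
  moreover have "(f w, f v) \<in> parcs H" using w f calculation by (auto simp: adj_iso_def)
  ultimately show ?case using w(2) by auto
qed simp

lemma adj_iso_card_diff_le:
  assumes E: "simple E" and D: "simple D" and f: "adj_iso f (aor_graph E) (aor_graph D)"
    and RS: "R \<in> aor E" "S \<in> aor E"
  shows "card (f R - f S) \<le> card (R - S)"
proof -
  have "f R \<in> aor D" using f RS by (metis adj_iso_def bij_betwE pverts_aor_graph)
  moreover have "(f R, f S) \<in> parcs (aor_graph D) ^^ card (R - S)"
    using adj_iso_relpow[OF f pair_wf_aor_graph aor_graph_relpow_card[OF E RS]] RS by simp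
  ultimately show ?thesis using aor_graph_relpow_card_le[OF D] by blast
qed

text \<open>The map and its inverse both do not increase distances, so \<open>card (R - S)\<close>
  is preserved. By \<open>between_iff\<close> betweenness is then preserved too, and with it the
  interval sizes, however different the underlying graphs are.\<close>

lemma hull_ineq_adj_iso:
  assumes E: "simple E" and D: "simple D" and f: "adj_iso f (aor_graph E) (aor_graph D)"
    and h: "hull_ineq E"
  shows "hull_ineq D"
proof -
  have b: "bij_betw f (aor E) (aor D)" using f by (simp add: adj_iso_def)
  have im: "f R \<in> aor D" if "R \<in> aor E" for R using b that by (auto dest: bij_betwE)
  let ?g = "the_inv_into (aor E) f"
  have g: "adj_iso ?g (aor_graph D) (aor_graph E)" using adj_iso_inv[OF f] by simp
  have gf: "?g (f R) = R" if "R \<in> aor E" for R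
    using the_inv_into_f_f[OF bij_betw_imp_inj_on[OF b] that] .
  have card_eq: "card (f R - f S) = card (R - S)" if "R \<in> aor E" "S \<in> aor E" for R S
    using adj_iso_card_diff_le[OF E D f that] adj_iso_card_diff_le[OF D E g im[OF that(1)] im[OF that(2)]]
      gf that by simp
  have eq: "card (aor_ext D (f R \<inter> f S)) = card (aor_ext E (R \<inter> S))" if RS: "R \<in> aor E" "S \<in> aor E" for R S
  proof -
    have "f R \<inter> f S \<subseteq> f T \<longleftrightarrow> R \<inter> S \<subseteq> T" if T: "T \<in> aor E" for T
      using between_iff[OF D im im im, OF RS T] between_iff[OF E RS T] card_eq RS T by simp
    then have "aor_ext D (f R \<inter> f S) = f ` aor_ext E (R \<inter> S)"
      unfolding aor_ext_def bij_betw_imp_surj_on[OF b, symmetric] by blast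
    moreover have "inj_on f (aor_ext E (R \<inter> S))"
      using bij_betw_imp_inj_on[OF b] by (rule inj_on_subset) (auto simp: aor_ext_def)
    ultimately show ?thesis by (simp add: card_image)
  qed
  show ?thesis
    unfolding hull_ineq_def bij_betw_imp_surj_on[OF b, symmetric]
    using h eq by (simp add: hull_ineq_def)
qed

section \<open>Cartesian products\<close>

lemma pverts_cart_prod_Nil [simp]: "pverts (cart_prod []) = {[]}"
  by (simp add: cart_prod_def)

lemma pverts_cart_prod_Cons:
  "pverts (cart_prod (H # Hs)) = {x # xs | x xs. x \<in> pverts H \<and> xs \<in> pverts (cart_prod Hs)}"
  by (auto simp: cart_prod_def Let_def set_Cons_def)

lemma length_cart_prod: "xs \<in> pverts (cart_prod Hs) \<Longrightarrow> length xs = length Hs"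
  by (induction Hs arbitrary: xs) (auto simp: pverts_cart_prod_Cons)

lemma parcs_cart_prod_Nil [simp]: "parcs (cart_prod []) = {}"
  by (simp add: cart_prod_def)

lemma parcs_cart_prod_iff:
  "(xs, ys) \<in> parcs (cart_prod Hs) \<longleftrightarrow>
    xs \<in> pverts (cart_prod Hs) \<and> ys \<in> pverts (cart_prod Hs) \<and>
    (\<exists>i < length Hs. (xs ! i, ys ! i) \<in> parcs (Hs ! i) \<and>
      (\<forall>j < length Hs. j \<noteq> i \<longrightarrow> xs ! j = ys ! j))"
  by (simp add: cart_prod_def Let_def)

lemma parcs_cart_prod_Cons:
  assumes "x \<in> pverts H" "y \<in> pverts H" "xs \<in> pverts (cart_prod Hs)" "ys \<in> pverts (cart_prod Hs)"
  shows "(x # xs, y # ys) \<in> parcs (cart_prod (H # Hs)) \<longleftrightarrow>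
    (x, y) \<in> parcs H \<and> xs = ys \<or> x = y \<and> (xs, ys) \<in> parcs (cart_prod Hs)"
proof -
  have eq: "xs = ys \<longleftrightarrow> (\<forall>j < length Hs. xs ! j = ys ! j)"
    using assms length_cart_prod nth_equalityI by metis
  show ?thesis
    using assms unfolding parcs_cart_prod_iff pverts_cart_prod_Cons eq
    by (simp add: Ex_less_Suc2 All_less_Suc2) blast
qed

lemma pair_wf_cart_prod: "pair_wf_digraph (cart_prod Hs)"
  by unfold_locales (auto simp: parcs_cart_prod_iff)

lemma pverts_cart_prod_append:
  "pverts (cart_prod (Hs @ Ks)) =
    {xs @ ys | xs ys. xs \<in> pverts (cart_prod Hs) \<and> ys \<in> pverts (cart_prod Ks)}"
proof (induction Hs)
  case (Cons H Hs)
  have "zs \<in> pverts (cart_prod ((H # Hs) @ Ks)) \<longleftrightarrow>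
      (\<exists>x xs ys. zs = (x # xs) @ ys \<and> x \<in> pverts H \<and> xs \<in> pverts (cart_prod Hs) \<and> ys \<in> pverts (cart_prod Ks))" for zs
    unfolding append_Cons pverts_cart_prod_Cons Cons.IH by blast
  then show ?case unfolding pverts_cart_prod_Cons by blast
qed simp

lemma parcs_cart_prod_append:
  assumes "xs \<in> pverts (cart_prod Hs)" "xs' \<in> pverts (cart_prod Hs)"
    and ys: "ys \<in> pverts (cart_prod Ks)" "ys' \<in> pverts (cart_prod Ks)"
  shows "(xs @ ys, xs' @ ys') \<in> parcs (cart_prod (Hs @ Ks)) \<longleftrightarrow>
    (xs, xs') \<in> parcs (cart_prod Hs) \<and> ys = ys' \<or> xs = xs' \<and> (ys, ys') \<in> parcs (cart_prod Ks)"
  using assms(1,2)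
proof (induction Hs arbitrary: xs xs')
  case (Cons H Hs)
  then obtain x as y bs where xs: "xs = x # as" "xs' = y # bs" "x \<in> pverts H" "y \<in> pverts H"
    "as \<in> pverts (cart_prod Hs)" "bs \<in> pverts (cart_prod Hs)"
    unfolding pverts_cart_prod_Cons by blast
  have app: "zs @ ws \<in> pverts (cart_prod (Hs @ Ks))"
    if "zs \<in> pverts (cart_prod Hs)" "ws \<in> pverts (cart_prod Ks)" for zs ws
    using that unfolding pverts_cart_prod_append by blast
  have len: "length as = length bs" using xs length_cart_prod by metis
  show ?case
    using Cons.IH[OF xs(5,6)] xs app ys len by (auto simp: parcs_cart_prod_Cons)
qed simp

lemma adj_iso_singleton: "adj_iso (\<lambda>x. [x]) H (cart_prod [H])"
proof -
  have "bij_betw (\<lambda>x. [x]) (pverts H) (pverts (cart_prod [H]))"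
    by (auto simp: bij_betw_def inj_on_def pverts_cart_prod_Cons)
  then show ?thesis by (simp add: adj_iso_def parcs_cart_prod_Cons)
qed

lemma aor_empty: "aor {} = {{}}"
  by (auto simp: aor_def acyclic_def)

lemma adj_iso_empty: "adj_iso (\<lambda>_. []) (aor_graph {}) (cart_prod [])"
  by (simp add: adj_iso_def aor_empty bij_betw_def) (simp add: aor_graph_def)

text \<open>Differences add over the two edge sets. Their sum is 1 exactly when one part differs in
  a single edge and the other agrees, which is adjacency in the product.\<close>

lemma (in one_sum) adj_iso_append:
  assumes f: "adj_iso f (aor_graph E1) (cart_prod Hs)" and g: "adj_iso g (aor_graph E2) (cart_prod Ks)"
  shows "adj_iso (\<lambda>R. f (R \<inter> E1) @ g (R \<inter> E2)) (aor_graph (E1 \<union> E2)) (cart_prod (Hs @ Ks))"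
proof -
  let ?h = "\<lambda>R. f (R \<inter> E1) @ g (R \<inter> E2)"
  have bf: "bij_betw f (aor E1) (pverts (cart_prod Hs))" and bg: "bij_betw g (aor E2) (pverts (cart_prod Ks))"
    using f g by (simp_all add: adj_iso_def)
  have fv: "f R \<in> pverts (cart_prod Hs)" if "R \<in> aor E1" for R
    using bf that by (auto dest: bij_betwE)
  have gv: "g R \<in> pverts (cart_prod Ks)" if "R \<in> aor E2" for R
    using bg that by (auto dest: bij_betwE)
  have feq: "f A = f B \<longleftrightarrow> A = B" if "A \<in> aor E1" "B \<in> aor E1" for A B
    using bij_betw_imp_inj_on[OF bf] that by (auto dest: inj_onD)
  have geq: "g A = g B \<longleftrightarrow> A = B" if "A \<in> aor E2" "B \<in> aor E2" for A B
    using bij_betw_imp_inj_on[OF bg] that by (auto dest: inj_onD)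
  have inj: "inj_on ?h (aor (E1 \<union> E2))"
  proof (rule inj_onI)
    fix R S assume RS: "R \<in> aor (E1 \<union> E2)" "S \<in> aor (E1 \<union> E2)" "?h R = ?h S"
    \<comment> \<open>Equal lengths of the first blocks allow the concatenated lists to be compared
      block by block.\<close>
    have "length (f (R \<inter> E1)) = length (f (S \<inter> E1))"
      using fv aor_Int(1) RS length_cart_prod by metis
    then have "f (R \<inter> E1) = f (S \<inter> E1)" "g (R \<inter> E2) = g (S \<inter> E2)" using RS(3) by auto
    then have "R \<inter> E1 = S \<inter> E1" "R \<inter> E2 = S \<inter> E2" using feq geq aor_Int RS by auto
    then show "R = S" using aor_Un_split RS by metis
  qed
  have "?h ` aor (E1 \<union> E2) = pverts (cart_prod (Hs @ Ks))"
  proof (intro equalityI subsetI)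
    fix zs assume "zs \<in> ?h ` aor (E1 \<union> E2)"
    then show "zs \<in> pverts (cart_prod (Hs @ Ks))"
      unfolding pverts_cart_prod_append using fv gv aor_Int by blast
  next
    fix zs assume "zs \<in> pverts (cart_prod (Hs @ Ks))"
    then obtain A B where AB: "A \<in> aor E1" "B \<in> aor E2" "zs = f A @ g B"
      unfolding pverts_cart_prod_append bij_betw_imp_surj_on[OF bf, symmetric]
        bij_betw_imp_surj_on[OF bg, symmetric] by blast
    then have "zs = ?h (A \<union> B)" using Un_Int_left[OF aor_sub aor_sub, OF AB(1,2)] by simp
    then show "zs \<in> ?h ` aor (E1 \<union> E2)" using aor_Un[OF AB(1,2)] by blast
  qed
  moreover have "(?h R, ?h S) \<in> parcs (cart_prod (Hs @ Ks)) \<longleftrightarrow> (R, S) \<in> parcs (aor_graph (E1 \<union> E2))"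
    if RS: "R \<in> aor (E1 \<union> E2)" "S \<in> aor (E1 \<union> E2)" for R S
  proof -
    note I = aor_Int[OF RS(1)] aor_Int[OF RS(2)]
    let ?A = "R \<inter> E1 - S \<inter> E1" and ?B = "R \<inter> E2 - S \<inter> E2"
    have fin: "finite ?A" "finite ?B" using simple[THEN simpleD(1)] by auto
    have eqs: "card ?A = 0 \<longleftrightarrow> R \<inter> E1 = S \<inter> E1" "card ?B = 0 \<longleftrightarrow> R \<inter> E2 = S \<inter> E2"
      using fin aor_subset_eq[OF I(1,3)] aor_subset_eq[OF I(2,4)] by auto
    have "R - S = ?A \<union> ?B" using aor_sub[OF RS(1)] by auto
    then have "card (R - S) = card ?A + card ?B"
      using fin disj by (subst card_Un_disjoint[symmetric]) auto
    then have "card (R - S) = 1 \<longleftrightarrow>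
        card ?A = 1 \<and> R \<inter> E2 = S \<inter> E2 \<or> R \<inter> E1 = S \<inter> E1 \<and> card ?B = 1"
      unfolding eqs[symmetric] by auto
    also have "\<dots> \<longleftrightarrow> (f (R \<inter> E1), f (S \<inter> E1)) \<in> parcs (cart_prod Hs) \<and> g (R \<inter> E2) = g (S \<inter> E2) \<or>
        f (R \<inter> E1) = f (S \<inter> E1) \<and> (g (R \<inter> E2), g (S \<inter> E2)) \<in> parcs (cart_prod Ks)"
      using f g I feq geq by (simp add: adj_iso_def aor_graph_def)
    also have "\<dots> \<longleftrightarrow> (?h R, ?h S) \<in> parcs (cart_prod (Hs @ Ks))"
      using parcs_cart_prod_append I fv gv by metis
    finally show ?thesis using RS by (simp add: aor_graph_def)
  qed
  ultimately show ?thesis using inj by (simp add: adj_iso_def bij_betw_def)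
qed

lemma adj_iso_relabel:
  assumes f: "inj_on f V" and E: "finite E" "E \<subseteq> V \<times> V"
  shows "adj_iso ((`) (map_prod f f)) (aor_graph E) (aor_graph (map_prod f f ` E))"
proof -
  let ?f = "map_prod f f"
  have inj: "inj_on ?f E" using inj_on_map_prod_image[OF f] E(2) by (rule inj_on_subset)
  have "inj_on ((`) ?f) (aor E)"
    using inj_on_image_Pow[OF inj] by (rule inj_on_subset) (auto simp: aor_def)
  moreover have "card (?f ` R - ?f ` S) = card (R - S)" if "R \<in> aor E" "S \<in> aor E" for R S
  proof -
    have sub: "R \<subseteq> E" "S \<subseteq> E" using that by (auto dest: aor_sub)
    then have "?f ` R - ?f ` S = ?f ` (R - S)"
      by (intro inj_on_image_set_diff[OF inj, symmetric]) auto
    moreover have "inj_on ?f (R - S)" using inj by (rule inj_on_subset) (use sub in auto)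
    ultimately show ?thesis by (simp add: card_image)
  qed
  ultimately show ?thesis
    by (auto simp: adj_iso_def bij_betw_def aor_relabel[OF f E] aor_graph_def)
qed

lemma map_prod_clique: "inj_on f X \<Longrightarrow> map_prod f f ` clique X = clique (f ` X)"
  by (auto simp: clique_def inj_on_def image_iff)

lemma ac_complete_graph: "ac (complete_graph n) = aor_graph (clique {..<n})"
proof -
  have "parcs (complete_graph n) = clique {..<n}" by (auto simp: complete_graph_def clique_def)
  then show ?thesis using ac_eq_aor_graph[of "complete_graph n"] simple_clique[of "{..<n}"] by simp
qed

lemma adj_iso_clique_ac_complete:
  assumes "finite X"
  obtains f where "adj_iso f (aor_graph (clique X)) (ac (complete_graph (card X)))"
proof -
  obtain f where f: "bij_betw f X {..<card X}"
    using ex_bij_betw_finite_nat[OF assms] by (auto simp: atLeast0LessThan)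
  have "clique X \<subseteq> X \<times> X" by (auto simp: clique_def)
  from adj_iso_relabel[OF bij_betw_imp_inj_on[OF f] finite_clique[OF assms] this]
  show ?thesis
    using that map_prod_clique[OF bij_betw_imp_inj_on[OF f]] bij_betw_imp_surj_on[OF f]
    by (auto simp: ac_complete_graph)
qed

text \<open>Realises a product by an actual graph, to which the one-sum argument applies. Each
  clique occupies a row of its own in \<open>nat \<times> nat\<close>; the new one goes into row
  \<open>length ns\<close>, disjoint from the earlier rows.\<close>

lemma ex_disjoint_cliques:
  "\<exists>E :: (nat \<times> nat) rel. simple E \<and> E \<subseteq> ({..<length ns} \<times> UNIV) \<times> ({..<length ns} \<times> UNIV) \<and>
    hull_ineq E \<and> (\<exists>f. adj_iso f (aor_graph E) (cart_prod (map (\<lambda>n. ac (complete_graph n)) ns)))"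
proof (induction ns)
  case Nil
  have "hull_ineq ({} :: (nat \<times> nat) rel)" by (simp add: hull_ineq_def aor_ext_def aor_empty)
  moreover have "simple ({} :: (nat \<times> nat) rel)" by (simp add: simple_def sym_def irrefl_def)
  ultimately show ?case using adj_iso_empty by (intro exI[of _ "{}"]) auto
next
  case (Cons n ns)
  then obtain E :: "(nat \<times> nat) rel" and g where E: "simple E" "E \<subseteq> ({..<length ns} \<times> UNIV) \<times> ({..<length ns} \<times> UNIV)"
      "hull_ineq E" "adj_iso g (aor_graph E) (cart_prod (map (\<lambda>n. ac (complete_graph n)) ns))"
    by blast
  define X where "X = {length ns} \<times> {..<n}"
  have X: "finite X" "card X = n" by (simp_all add: X_def)
  have XX: "clique X \<subseteq> X \<times> X" by (auto simp: clique_def)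
  interpret one_sum "clique X" E X "{..<length ns} \<times> UNIV" "(0, 0)"
    using E X XX by unfold_locales (auto simp: simple_clique X_def)
  obtain f where f: "adj_iso f (aor_graph (clique X)) (ac (complete_graph n))"
    using adj_iso_clique_ac_complete[OF X(1)] X(2) by auto
  have "\<exists>h. adj_iso h (aor_graph (clique X \<union> E)) (cart_prod (map (\<lambda>n. ac (complete_graph n)) (n # ns)))"
    using adj_iso_append[OF adj_iso_comp[OF f adj_iso_singleton] E(4)] by auto
  moreover have "hull_ineq (clique X \<union> E)"
    by (rule hull_ineq_Un[OF hull_ineq_clique[OF X(1)] E(3)])
  moreover have "clique X \<union> E \<subseteq> ({..<length (n # ns)} \<times> UNIV) \<times> ({..<length (n # ns)} \<times> UNIV)"
    using XX E(2) by (force simp: X_def)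
  ultimately show ?case using simple_Un by blast
qed

section \<open>Induced cycles\<close>

text \<open>
  Orientations are coded by the set of indices whose edge is directed from \<open>t i\<close> to \<open>h i\<close>.
\<close>

locale edge_family =
  fixes I :: "'i set" and t h :: "'i \<Rightarrow> 'a"
  assumes fin: "finite I"
    and inj: "\<And>i j. i \<in> I \<Longrightarrow> j \<in> I \<Longrightarrow> t i = t j \<Longrightarrow> h i = h j \<Longrightarrow> i = j"
    and anti: "\<And>i j. i \<in> I \<Longrightarrow> j \<in> I \<Longrightarrow> t i = h j \<Longrightarrow> h i \<noteq> t j"
begin

definition edges :: "'a rel" where
  "edges = {(t i, h i) | i. i \<in> I} \<union> {(h i, t i) | i. i \<in> I}"

definition orient :: "'i set \<Rightarrow> 'a rel" where
  "orient Z = {(t i, h i) | i. i \<in> I \<and> i \<in> Z} \<union> {(h i, t i) | i. i \<in> I \<and> i \<notin> Z}"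

text \<open>The interval between two coded orientations: edges in \<open>A \<inter> B\<close> are
  forward in both, edges outside \<open>A \<union> B\<close> are backward in both, and all others
  are free up to acyclicity.\<close>

definition extensions :: "'i set \<Rightarrow> 'i set \<Rightarrow> 'i set set" where
  "extensions A B = {Z. Z \<subseteq> I \<and> acyclic (orient Z) \<and> A \<inter> B \<subseteq> Z \<and> Z \<subseteq> A \<union> B}"

lemma finite_edges: "finite edges"
  using fin by (simp add: edges_def Setcompr_eq_image)

lemma finite_extensions: "finite (extensions A B)"
  using fin by (simp add: extensions_def)

lemma orient_iff:
  assumes "i \<in> I"
  shows "(t i, h i) \<in> orient Z \<longleftrightarrow> i \<in> Z" "(h i, t i) \<in> orient Z \<longleftrightarrow> i \<notin> Z"
  using assms inj anti unfolding orient_def by blast+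

lemma aor_edges: "aor edges = orient ` {Z. Z \<subseteq> I \<and> acyclic (orient Z)}"
proof (intro equalityI subsetI)
  fix R assume R: "R \<in> aor edges"
  define Z where "Z = {i \<in> I. (t i, h i) \<in> R}"
  have rev: "(h i, t i) \<in> R \<longleftrightarrow> i \<notin> Z" if "i \<in> I" for i
    using aor_iff[OF R, of "h i" "t i"] that by (auto simp: edges_def Z_def)
  have "R = orient Z"
  proof (intro equalityI subrelI)
    fix x y assume xy: "(x, y) \<in> R"
    then have "(x, y) \<in> edges" using aor_sub[OF R] by auto
    then obtain i where "i \<in> I" "(x, y) = (t i, h i) \<or> (x, y) = (h i, t i)"
      by (auto simp: edges_def)
    then show "(x, y) \<in> orient Z" using xy rev orient_iff by (auto simp: Z_def)
  next
    fix x y assume "(x, y) \<in> orient Z"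
    then show "(x, y) \<in> R" using rev by (auto simp: orient_def Z_def)
  qed
  then show "R \<in> orient ` {Z. Z \<subseteq> I \<and> acyclic (orient Z)}"
    using aor_acyclic[OF R] by (auto simp: Z_def)
next
  fix R assume "R \<in> orient ` {Z. Z \<subseteq> I \<and> acyclic (orient Z)}"
  then obtain Z where Z: "Z \<subseteq> I" "acyclic (orient Z)" "R = orient Z" by auto
  have "(u, v) \<in> orient Z \<longleftrightarrow> (v, u) \<notin> orient Z" if "(u, v) \<in> edges" for u v
    using that orient_iff[of _ Z] by (auto simp: edges_def)
  moreover have "orient Z \<subseteq> edges" by (auto simp: orient_def edges_def)
  ultimately show "R \<in> aor edges" using Z by (auto simp: aor_def)
qed

lemma card_ext_edges:
  assumes "A \<subseteq> I" "B \<subseteq> I"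
  shows "card (aor_ext edges (orient A \<inter> orient B)) = card (extensions A B)"
proof -
  have "orient A \<inter> orient B \<subseteq> orient Z \<longleftrightarrow> A \<inter> B \<subseteq> Z \<and> Z \<subseteq> A \<union> B" if "Z \<subseteq> I" for Z
  proof
    assume sub: "orient A \<inter> orient B \<subseteq> orient Z"
    have "i \<in> Z" if "i \<in> A" "i \<in> B" for i
      using sub that assms orient_iff(1)[of i] by blast
    moreover have "i \<in> A \<union> B" if "i \<in> Z" for i
      using sub that \<open>Z \<subseteq> I\<close> orient_iff(2)[of i] by blast
    ultimately show "A \<inter> B \<subseteq> Z \<and> Z \<subseteq> A \<union> B" by auto
  next
    assume Z: "A \<inter> B \<subseteq> Z \<and> Z \<subseteq> A \<union> B"
    show "orient A \<inter> orient B \<subseteq> orient Z"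
    proof (rule subrelI)
      fix x y assume xy: "(x, y) \<in> orient A \<inter> orient B"
      then obtain i where i: "i \<in> I" "x = t i \<and> y = h i \<or> x = h i \<and> y = t i"
        unfolding orient_def by blast
      then show "(x, y) \<in> orient Z"
        using xy Z orient_iff[OF i(1)] by auto
    qed
  qed
  then have "aor_ext edges (orient A \<inter> orient B) = orient ` extensions A B"
    unfolding aor_ext_def aor_edges extensions_def by blast
  moreover have "inj_on orient (extensions A B)"
  proof (rule inj_onI)
    fix Y Z assume "Y \<in> extensions A B" "Z \<in> extensions A B" and eq: "orient Y = orient Z"
    then have "Y \<subseteq> I" "Z \<subseteq> I" by (auto simp: extensions_def)
    then show "Y = Z" using orient_iff(1)[of _ Y] orient_iff(1)[of _ Z] eq by auto
  qed
  ultimately show ?thesis by (simp add: card_image)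
qed

lemma not_hull_ineq_edges:
  assumes sub: "A \<subseteq> I" "B \<subseteq> I" "C \<subseteq> I"
    and acyc: "acyclic (orient A)" "acyclic (orient B)" "acyclic (orient C)"
    and less: "card (extensions A B) * card (extensions B C) < card (extensions A C)"
  shows "\<not> hull_ineq edges"
proof
  assume "hull_ineq edges"
  moreover have "orient A \<in> aor edges" "orient B \<in> aor edges" "orient C \<in> aor edges"
    using sub acyc by (auto simp: aor_edges)
  ultimately have "card (aor_ext edges (orient A \<inter> orient C)) \<le>
      card (aor_ext edges (orient A \<inter> orient B)) * card (aor_ext edges (orient B \<inter> orient C))"
    unfolding hull_ineq_def by blast
  then show False using less by (simp add: card_ext_edges sub)
qed

lemma not_hull_ineq_induced:
  assumes E: "simple E" and f: "inj_on f V" and V: "t ` I \<union> h ` I \<subseteq> V"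
    and adj: "\<And>x y. x \<in> V \<Longrightarrow> y \<in> V \<Longrightarrow> (f x, f y) \<in> E \<longleftrightarrow> (x, y) \<in> edges"
    and no: "\<not> hull_ineq edges"
  shows "\<not> hull_ineq E"
proof
  assume "hull_ineq E"
  then have "hull_ineq (E \<inter> f ` V \<times> f ` V)" by (rule hull_ineq_Restr[OF E])
  also have sub: "edges \<subseteq> V \<times> V" using V by (auto simp: edges_def)
  then have "E \<inter> f ` V \<times> f ` V = map_prod f f ` edges"
    using adj by (fastforce simp: image_iff)
  finally show False using hull_ineq_relabel[OF f finite_edges sub] no by blast
qed

end

definition cyc_next :: "nat \<Rightarrow> nat \<Rightarrow> nat" where
  "cyc_next n i = (if Suc i = n then 0 else Suc i)"

context
  fixes n :: nat
  assumes n: "n \<ge> 4"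
begin

interpretation C: edge_family "{..<n}" "\<lambda>i. i" "cyc_next n"
  using n by unfold_locales (auto simp: cyc_next_def split: if_splits)

lemma cycle_not_acyclic: "\<not> acyclic (C.orient {..<n})"
proof -
  have arc: "(i, cyc_next n i) \<in> C.orient {..<n}" if "i < n" for i
    using that C.orient_iff(1) by auto
  have "(0, k) \<in> (C.orient {..<n})\<^sup>*" if "k < n" for k
    using that
  proof (induction k)
    case (Suc k)
    then have "(k, Suc k) \<in> C.orient {..<n}" using arc[of k] by (auto simp: cyc_next_def)
    then show ?case using Suc by (auto intro: rtrancl_into_rtrancl)
  qed simp
  from this[of "n - 1"] have "(0, n - 1) \<in> (C.orient {..<n})\<^sup>*" using n by simp
  moreover have "(n - 1, 0) \<in> C.orient {..<n}" using arc[of "n - 1"] n by (simp add: cyc_next_def)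
  ultimately have "(0, 0) \<in> (C.orient {..<n})\<^sup>+" by (rule rtrancl_into_trancl1)
  then show ?thesis by (auto simp: acyclic_def)
qed

text \<open>A vertex on a closed directed walk has an arc from and an arc to such vertices. These
  must use its two different cycle edges, which hence run in the same sense. Going once round, all
  edges run in one sense, so \<open>Z\<close> is empty or everything.\<close>

lemma cycle_acyclic:
  assumes Z: "Z \<subseteq> {..<n}" "Z \<noteq> {}" "Z \<noteq> {..<n}"
  shows "acyclic (C.orient Z)"
proof (rule ccontr)
  let ?R = "C.orient Z"
  define W where "W = {x. (x, x) \<in> ?R\<^sup>+}"
  assume "\<not> acyclic ?R"
  then obtain x0 where x0: "x0 \<in> W" by (auto simp: acyclic_def W_def)
  have R: "(x, y) \<in> ?R \<longleftrightarrow> x < n \<and> x \<in> Z \<and> y = cyc_next n x \<or> y < n \<and> y \<notin> Z \<and> x = cyc_next n y" for x y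
    by (auto simp: C.orient_def)
  have nxt: "cyc_next n x < n" if "x < n" for x using that by (auto simp: cyc_next_def)
  have inj: "x = y" if "cyc_next n x = cyc_next n y" "x < n" "y < n" for x y
    using that by (auto simp: cyc_next_def split: if_splits)
  have succ: "\<exists>y \<in> W. (x, y) \<in> ?R" if x: "x \<in> W" for x
  proof -
    obtain y where y: "(x, y) \<in> ?R" "(y, x) \<in> ?R\<^sup>*" using x by (auto simp: W_def dest: tranclD)
    then have "(y, y) \<in> ?R\<^sup>+" by (meson rtrancl_into_trancl1)
    then show ?thesis using y by (auto simp: W_def)
  qed
  have pred: "\<exists>y \<in> W. (y, x) \<in> ?R" if x: "x \<in> W" for x
  proof -
    obtain y where y: "(y, x) \<in> ?R" "(x, y) \<in> ?R\<^sup>*" using x by (auto simp: W_def dest: tranclD2)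
    then have "(y, y) \<in> ?R\<^sup>+" by (meson rtrancl_into_trancl2)
    then show ?thesis using y by (auto simp: W_def)
  qed
  have Wn: "x < n" if "x \<in> W" for x using succ[OF that] R nxt by auto
  have step: "cyc_next n x \<in> W \<and> (\<forall>z < n. x = cyc_next n z \<longrightarrow> (z \<in> Z \<longleftrightarrow> x \<in> Z))" if x: "x \<in> W" for x
  proof -
    obtain y z where y: "y \<in> W" "(x, y) \<in> ?R" and z: "z \<in> W" "(z, x) \<in> ?R"
      using succ[OF x] pred[OF x] by blast
    show ?thesis
    proof (cases "x \<in> Z")
      case True
      then have z': "z < n" "z \<in> Z" "x = cyc_next n z" using z R by auto
      then have "y = cyc_next n x" using y R inj by blast
      then show ?thesis using True y z' inj by blast
    next
      case False
      then have y': "y < n" "y \<notin> Z" "x = cyc_next n y" using y R by auto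
      then have "z = cyc_next n x" using z R inj by blast
      then show ?thesis using False z y' inj by blast
    qed
  qed
  have inZ: "cyc_next n x \<in> Z \<longleftrightarrow> x \<in> Z" if "x \<in> W" for x
    using step[of "cyc_next n x"] step[OF that] Wn[OF that] by blast
  \<comment> \<open>Two sweeps: from \<open>x0\<close> up to \<open>n - 1\<close>, then across the
    closing edge to 0 and through all vertices.\<close>
  have up: "x0 + k < n \<Longrightarrow> x0 + k \<in> W \<and> (x0 + k \<in> Z \<longleftrightarrow> x0 \<in> Z)" for k
  proof (induction k)
    case (Suc k)
    then show ?case using step[of "x0 + k"] inZ[of "x0 + k"] by (simp add: cyc_next_def)
  qed (simp add: x0)
  have "x0 + (n - 1 - x0) = n - 1" using Wn[OF x0] by simp
  then have last: "n - 1 \<in> W \<and> (n - 1 \<in> Z \<longleftrightarrow> x0 \<in> Z)" using up[of "n - 1 - x0"] n by simp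
  have all: "k < n \<Longrightarrow> k \<in> W \<and> (k \<in> Z \<longleftrightarrow> x0 \<in> Z)" for k
  proof (induction k)
    case 0
    then show ?case using step[of "n - 1"] inZ[of "n - 1"] last by (simp add: cyc_next_def)
  next
    case (Suc k)
    then show ?case using step[of k] inZ[of k] by (simp add: cyc_next_def)
  qed
  then show False using Z by blast
qed

text \<open>\<open>?A\<close> and \<open>?C\<close> are opposite, so all \<open>2 ^ n - 2\<close>
  acyclic orientations lie between them. \<open>?A\<close> and \<open>?B\<close> agree on edges 0
  and 1, and one choice for the other edges closes the directed cycle, leaving at most
  \<open>2 ^ (n - 2) - 1\<close>. \<open>?B\<close> and \<open>?C\<close> differ only on edges 0 and
  1, giving at most 4. The product is at most \<open>2 ^ n - 4\<close>: the single loss is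
  multiplied by 4. With \<open>n \<ge> 4\<close>, edge 3 exists and keeps \<open>?C\<close>
  nonempty.\<close>

lemma not_hull_ineq_cycle: "\<not> hull_ineq C.edges"
proof (rule C.not_hull_ineq_edges)
  let ?A = "{0, 1, 2 :: nat}" and ?B = "{0, 1} \<union> {3..<n}" and ?C = "{3..<n}"
  show sub: "?A \<subseteq> {..<n}" "?B \<subseteq> {..<n}" "?C \<subseteq> {..<n}" using n by auto
  have "3 \<in> ?B" "3 \<in> ?C" "3 \<notin> ?A" "2 \<notin> ?B" "2 \<notin> ?C" "3 \<in> {..<n}" "2 \<in> {..<n}" using n by auto
  then have "?A \<noteq> {..<n}" "?B \<noteq> {..<n}" "?C \<noteq> {..<n}" "?C \<noteq> {}" by blast+
  then show "acyclic (C.orient ?A)" "acyclic (C.orient ?B)" "acyclic (C.orient ?C)"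
    using cycle_acyclic sub by auto
  have "C.extensions ?A ?B \<subseteq> (\<lambda>Y. {0, 1} \<union> Y) ` (Pow {2..<n} - {{2..<n}})"
  proof
    fix Z assume Z: "Z \<in> C.extensions ?A ?B"
    then have s: "Z \<subseteq> {..<n}" "acyclic (C.orient Z)" "{0, 1} \<subseteq> Z" by (auto simp: C.extensions_def)
    have "Z \<noteq> {..<n}" using s(2) cycle_not_acyclic by auto
    have split: "{..<n} = {0, 1} \<union> {2..<n}" using n by auto
    have "Z = {0, 1} \<union> (Z \<inter> {2..<n})" using s(1,3) unfolding split by blast
    moreover have "Z \<inter> {2..<n} \<noteq> {2..<n}"
      using s(1,3) \<open>Z \<noteq> {..<n}\<close> unfolding split by blast
    ultimately show "Z \<in> (\<lambda>Y. {0, 1} \<union> Y) ` (Pow {2..<n} - {{2..<n}})" by blast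
  qed
  then have "card (C.extensions ?A ?B) \<le> card (Pow {2..<n} - {{2..<n}})"
    by (intro surj_card_le) auto
  also have "\<dots> = 2 ^ (n - 2) - 1" by (simp add: card_Pow)
  finally have 1: "card (C.extensions ?A ?B) \<le> 2 ^ (n - 2) - 1" .
  have "C.extensions ?B ?C \<subseteq> (\<lambda>Y. Y \<union> {3..<n}) ` Pow {0, 1}"
  proof
    fix Z assume "Z \<in> C.extensions ?B ?C"
    then have "{3..<n} \<subseteq> Z" "Z \<subseteq> {0, 1} \<union> {3..<n}" by (auto simp: C.extensions_def)
    then have "Z = (Z \<inter> {0, 1}) \<union> {3..<n}" by auto
    then show "Z \<in> (\<lambda>Y. Y \<union> {3..<n}) ` Pow {0, 1}" by blast
  qed
  then have "card (C.extensions ?B ?C) \<le> card (Pow {0, 1 :: nat})"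
    by (intro surj_card_le) auto
  also have "\<dots> = 4" by (simp add: card_Pow)
  finally have 2: "card (C.extensions ?B ?C) \<le> 4" .
  have "?A \<union> ?C = {..<n}" "?A \<inter> ?C = {}" using n by auto
  then have "Pow {..<n} - {{}, {..<n}} \<subseteq> C.extensions ?A ?C"
    using cycle_acyclic unfolding C.extensions_def by auto
  then have "card (Pow {..<n} - {{}, {..<n}}) \<le> card (C.extensions ?A ?C)"
    by (rule card_mono[OF C.finite_extensions])
  moreover have "card (Pow {..<n} - {{}, {..<n}}) = 2 ^ n - 2"
  proof -
    have "0 \<in> {..<n}" using n by simp
    then have "{} \<noteq> {..<n}" by blast
    then show ?thesis by (subst card_Diff_subset) (auto simp: card_Pow)
  qed
  ultimately have 3: "2 ^ n - 2 \<le> card (C.extensions ?A ?C)" by simp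
  obtain m where "n = m + 2" using n by (metis add.commute le_Suc_ex numeral_Bit0 add_leD1)
  then have "(2 :: nat) ^ n = 4 * 2 ^ (n - 2)" by simp
  moreover have "(2 :: nat) ^ (n - 2) \<ge> 1" by simp
  ultimately have "(2 ^ (n - 2) - 1) * 4 < (2 :: nat) ^ n - 2" by arith
  then show "card (C.extensions ?A ?B) * card (C.extensions ?B ?C) < card (C.extensions ?A ?C)"
    using mult_le_mono[OF 1 2] 3 by linarith
qed

lemma not_hull_ineq_induced_cycle:
  assumes E: "simple E" and f: "inj_on f {..<n}"
    and adj: "\<And>i j. i < j \<Longrightarrow> j < n \<Longrightarrow> (f i, f j) \<in> E \<longleftrightarrow> j = Suc i \<or> i = 0 \<and> Suc j = n"
  shows "\<not> hull_ineq E"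
proof (rule C.not_hull_ineq_induced[OF E f])
  show "(\<lambda>i. i) ` {..<n} \<union> cyc_next n ` {..<n} \<subseteq> {..<n}" by (auto simp: cyc_next_def)
  have edges: "(i, j) \<in> C.edges \<longleftrightarrow> i < n \<and> j = cyc_next n i \<or> j < n \<and> i = cyc_next n j" for i j
    by (auto simp: C.edges_def)
  fix i j assume ij: "i \<in> {..<n}" "j \<in> {..<n}"
  have sym: "(f i, f j) \<in> E \<longleftrightarrow> (f j, f i) \<in> E" using simpleD(2)[OF E] by blast
  consider "i < j" | "j < i" | "i = j" by linarith
  then show "(f i, f j) \<in> E \<longleftrightarrow> (i, j) \<in> C.edges"
  proof cases
    case 1
    then show ?thesis using adj[of i j] ij n by (auto simp: edges cyc_next_def)
  next
    case 2
    then show ?thesis using adj[of j i] ij n sym by (auto simp: edges cyc_next_def)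
  next
    case 3
    then show ?thesis using simpleD(3)[OF E] ij n by (auto simp: edges cyc_next_def)
  qed
qed (rule not_hull_ineq_cycle)

end

section \<open>Induced diamonds\<close>

text \<open>The diamond has edges \<open>01\<close>, \<open>02\<close>, \<open>12\<close>, \<open>03\<close>, \<open>13\<close>; the hulls below have sizes 2, 4 and 9.\<close>

definition dia_tail :: "nat \<Rightarrow> nat" where
  "dia_tail i = [0, 0, 1, 0, 1] ! i"

definition dia_head :: "nat \<Rightarrow> nat" where
  "dia_head i = [1, 2, 2, 3, 3] ! i"

interpretation D: edge_family "{0, 1, 2, 3, 4}" dia_tail dia_head
  by unfold_locales (auto simp: dia_tail_def dia_head_def)

lemma dia_simps [simp]:
  "dia_tail 0 = 0" "dia_tail 1 = 0" "dia_tail (Suc 0) = 0" "dia_tail 2 = 1" "dia_tail 3 = 0" "dia_tail 4 = 1"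
  "dia_head 0 = 1" "dia_head 1 = 2" "dia_head (Suc 0) = 2" "dia_head 2 = 2" "dia_head 3 = 3" "dia_head 4 = 3"
  by (simp_all add: dia_tail_def dia_head_def)

text \<open>The hypotheses fix the arc from 2 to 1 and forbid a directed triangle on either side of
  the edge 01. The ends of 01 are ranked 0 and 2; each of the other two vertices lies below, between
  or above them, which leaves the ranks -1, 1 and 3.\<close>

lemma dia_acyclic:
  assumes "2 \<notin> Z" "1 \<in> Z \<longrightarrow> 0 \<in> Z" "0 \<notin> Z \<longrightarrow> 3 \<in> Z \<longrightarrow> 4 \<in> Z" "0 \<in> Z \<longrightarrow> 4 \<in> Z \<longrightarrow> 3 \<in> Z"
  shows "acyclic (D.orient Z)"
proof (rule acyclic_if_rank)
  define r :: "nat \<Rightarrow> int" where "r x =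
    (if x = 0 then (if 0 \<in> Z then 0 else 2) else
     if x = 1 then (if 0 \<in> Z then 2 else 0) else
     if x = 2 then (if 1 \<in> Z then 1 else -1) else
     if 3 \<in> Z \<and> 4 \<in> Z then 3 else if 3 \<notin> Z \<and> 4 \<notin> Z then -1 else 1)" for x
  fix x y assume "(x, y) \<in> D.orient Z"
  then obtain i where i: "i \<in> {0, 1, 2, 3, 4}"
    and xy: "i \<in> Z \<and> x = dia_tail i \<and> y = dia_head i \<or> i \<notin> Z \<and> x = dia_head i \<and> y = dia_tail i"
    unfolding D.orient_def by blast
  have r: "r 0 = (if 0 \<in> Z then 0 else 2)" "r 1 = (if 0 \<in> Z then 2 else 0)"
    "r 2 = (if 1 \<in> Z then 1 else -1)"
    "r 3 = (if 3 \<in> Z \<and> 4 \<in> Z then 3 else if 3 \<notin> Z \<and> 4 \<notin> Z then -1 else 1)"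
    by (simp_all add: r_def)
  from i consider "i = 0" | "i = 1" | "i = 2" | "i = 3" | "i = 4" by blast
  then show "r x < r y"
  proof cases
    case 1
    then show ?thesis using xy r by auto
  next
    case 2
    then show ?thesis using xy r assms(2) by auto
  next
    case 3
    then show ?thesis using xy r assms(1,2) by auto
  next
    case 4
    show ?thesis
    proof (cases "3 \<in> Z")
      case True
      then have "x = 0" "y = 3" using xy 4 by simp_all
      then show ?thesis using r(1,4) True assms(3) by simp
    next
      case False
      then have "x = 3" "y = 0" using xy 4 by simp_all
      then show ?thesis using r(1,4) False assms(4) by simp
    qed
  next
    case 5
    show ?thesis
    proof (cases "4 \<in> Z")
      case True
      then have "x = 1" "y = 3" using xy 5 by simp_all
      then show ?thesis using r(2,4) True assms(4) by simp
    next
      case False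
      then have "x = 3" "y = 1" using xy 5 by simp_all
      then show ?thesis using r(2,4) False assms(3) by simp
    qed
  qed
qed

text \<open>All three orientations contain the arc from 2 to 1. \<open>?A\<close> and
  \<open>?B\<close> differ in one edge. From \<open>?B\<close> to \<open>?C\<close> the triangles
  force the edges 03, 01, 02 to be flipped in this order, a path of four orientations. Between
  \<open>?A\<close> and \<open>?C\<close>, the edge 01 backward allows three orientations and 01
  forward six.\<close>

lemma not_hull_ineq_diamond: "\<not> hull_ineq D.edges"
proof (rule D.not_hull_ineq_edges)
  let ?A = "{} :: nat set" and ?B = "{4} :: nat set" and ?C = "{0, 1, 3, 4} :: nat set"
  show "?A \<subseteq> {0, 1, 2, 3, 4}" "?B \<subseteq> {0, 1, 2, 3, 4}" "?C \<subseteq> {0, 1, 2, 3, 4}" by auto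
  show "acyclic (D.orient ?A)" "acyclic (D.orient ?B)" "acyclic (D.orient ?C)"
    by (rule dia_acyclic; simp)+
  have triangle: False if "acyclic R" "(x, y) \<in> R" "(y, z) \<in> R" "(z, x) \<in> R" for R :: "nat rel" and x y z
    using that unfolding acyclic_def by (meson trancl.simps)
  have "D.extensions ?A ?B \<subseteq> Pow {4}" unfolding D.extensions_def by auto
  then have 1: "card (D.extensions ?A ?B) \<le> 2"
    using card_mono[of "Pow {4 :: nat}"] by (simp add: card_Pow)
  have "D.extensions ?B ?C \<subseteq> {{4}, {3, 4}, {0, 3, 4}, {0, 1, 3, 4}}"
  proof
    fix Z assume "Z \<in> D.extensions ?B ?C"
    then have Z: "acyclic (D.orient Z)" "4 \<in> Z" "Z \<subseteq> {0, 1, 3, 4}"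
      unfolding D.extensions_def by auto
    have 1: "0 \<in> Z" if "1 \<in> Z"
    proof (rule ccontr)
      assume "0 \<notin> Z"
      then have "(1, 0) \<in> D.orient Z" "(0, 2) \<in> D.orient Z" "(2, 1) \<in> D.orient Z"
        using D.orient_iff[of 0 Z] D.orient_iff[of 1 Z] D.orient_iff[of 2 Z] that Z(3) by auto
      then show False by (rule triangle[OF Z(1)])
    qed
    have 2: "3 \<in> Z" if "0 \<in> Z"
    proof (rule ccontr)
      assume "3 \<notin> Z"
      then have "(0, 1) \<in> D.orient Z" "(1, 3) \<in> D.orient Z" "(3, 0) \<in> D.orient Z"
        using D.orient_iff[of 0 Z] D.orient_iff[of 3 Z] D.orient_iff[of 4 Z] that Z(2) by auto
      then show False by (rule triangle[OF Z(1)])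
    qed
    consider "3 \<notin> Z" | "3 \<in> Z" "0 \<notin> Z" | "0 \<in> Z" "1 \<notin> Z" | "1 \<in> Z" by blast
    then show "Z \<in> {{4}, {3, 4}, {0, 3, 4}, {0, 1, 3, 4}}"
      by cases (use Z 1 2 in blast)+
  qed
  then have "card (D.extensions ?B ?C) \<le> card {{4}, {3, 4}, {0, 3, 4}, {0, 1, 3, 4 :: nat}}"
    by (rule card_mono[rotated]) simp
  also have "\<dots> \<le> 4" by (simp add: card_insert_if)
  finally have 2: "card (D.extensions ?B ?C) \<le> 4" .
  let ?S = "{{}, {4}, {3, 4}, {0}, {0, 3}, {0, 3, 4}, {0, 1}, {0, 1, 3}, {0, 1, 3, 4}} :: nat set set"
  have "?S \<subseteq> D.extensions ?A ?C"
    unfolding D.extensions_def using dia_acyclic by (simp add: subset_iff)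
  then have "card ?S \<le> card (D.extensions ?A ?C)"
    by (rule card_mono[OF D.finite_extensions])
  moreover have "9 \<le> card ?S"
  proof -
    \<comment> \<open>Binary codes separate the nine sets, so distinctness reduces to comparing
      numerals.\<close>
    have "(\<lambda>Z. \<Sum>i \<in> Z. 2 ^ i) ` ?S = {0, 16, 24, 1, 9, 25, 3, 11, 27 :: int}" by simp
    then have "card ((\<lambda>Z. \<Sum>i \<in> Z. 2 ^ i :: int) ` ?S) = 9" by simp
    then show ?thesis using card_image_le[of ?S "\<lambda>Z. \<Sum>i \<in> Z. 2 ^ i :: int"] by simp
  qed
  ultimately have "9 \<le> card (D.extensions ?A ?C)" by simp
  then show "card (D.extensions ?A ?B) * card (D.extensions ?B ?C) < card (D.extensions ?A ?C)"
    using mult_le_mono[OF 1 2] by linarith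
qed

lemma not_hull_ineq_induced_diamond:
  assumes E: "simple E" and ne: "c \<noteq> d" "(c, d) \<notin> E" and ab: "(a, b) \<in> E"
    and "(a, c) \<in> E" "(b, c) \<in> E" "(a, d) \<in> E" "(b, d) \<in> E"
  shows "\<not> hull_ineq E"
proof -
  define f where "f = (!) [a, b, c, d]"
  have f: "f 0 = a" "f 1 = b" "f (Suc 0) = b" "f 2 = c" "f 3 = d" by (simp_all add: f_def)
  have V: "{..<4} = {0, 1, 2, 3 :: nat}" by auto
  have ne': "a \<noteq> b" "a \<noteq> c" "a \<noteq> d" "b \<noteq> c" "b \<noteq> d"
    using assms simpleD(3)[OF E] by blast+
  have no: "(x, x) \<notin> E" "(d, c) \<notin> E" for x
    using assms simpleD(2,3)[OF E] by blast+
  have yes: "(b, a) \<in> E" "(c, a) \<in> E" "(c, b) \<in> E" "(d, a) \<in> E" "(d, b) \<in> E"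
    using assms simpleD(2)[OF E] by blast+
  have edges: "D.edges = {(0,1),(0,2),(1,2),(0,3),(1,3),(1,0),(2,0),(2,1),(3,0),(3,1)}"
    unfolding D.edges_def Setcompr_eq_image by (simp only: image_insert image_empty dia_simps) auto
  show ?thesis
  proof (rule D.not_hull_ineq_induced[OF E])
    show "inj_on f {..<4}" using ne ne' unfolding V by (auto simp: inj_on_def f)
    show "dia_tail ` {0, 1, 2, 3, 4} \<union> dia_head ` {0, 1, 2, 3, 4} \<subseteq> {..<4}" by simp
    show "(f x, f y) \<in> E \<longleftrightarrow> (x, y) \<in> D.edges" if "x \<in> {..<4}" "y \<in> {..<4}" for x y
      using that assms(2-) no yes unfolding V edges by (elim insertE emptyE) (simp_all add: f)
  qed (rule not_hull_ineq_diamond)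
qed

section \<open>Structure of the graphs satisfying the inequality\<close>

text \<open>\<open>u\<close> separates any two of its non-adjacent neighbours. Induction over all
  such pairs at once makes a counterexample a shortest one: its walk is an induced path, and adding
  \<open>u\<close> gives an induced cycle, or a diamond if \<open>u\<close> is joined to an inner
  vertex.\<close>

lemma no_connection:
  assumes E: "simple E" and h: "hull_ineq E"
  shows "(u, a) \<in> E \<Longrightarrow> (u, b) \<in> E \<Longrightarrow> a \<noteq> b \<Longrightarrow> (a, b) \<notin> E \<Longrightarrow>
    (a, b) \<notin> {(x, y) \<in> E. x \<noteq> u \<and> y \<noteq> u} ^^ m"
proof (induction m arbitrary: a b rule: less_induct)
  case (less m)
  define D where "D = {(x, y) \<in> E. x \<noteq> u \<and> y \<noteq> u}"
  note IH = less.IH[folded D_def]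
  show ?case
    unfolding D_def[symmetric]
  proof
    assume "(a, b) \<in> D ^^ m"
    then obtain f where f: "f 0 = a" "f m = b" and arc: "\<And>i. i < m \<Longrightarrow> (f i, f (Suc i)) \<in> D"
      unfolding relpow_fun_conv by blast
    have seg: "(f i, f (i + k)) \<in> D ^^ k" if "i + k \<le> m" for i k
      using that
    proof (induction k)
      case (Suc k)
      then show ?case using arc[of "i + k"] by (auto intro: relpow_Suc_I)
    qed simp
    have to_b: "(f j, b) \<in> D ^^ (m - j)" and from_a: "(a, f j) \<in> D ^^ j" if "j \<le> m" for j
      using seg[of j "m - j"] seg[of 0 j] that f by simp_all
    have "m \<noteq> 0" using f less.prems(3) by metis
    moreover have "m \<noteq> 1" using f less.prems(4) arc[of 0] by (auto simp: D_def)
    ultimately have m: "m \<ge> 2" by simp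
    have fu: "f i \<noteq> u" if "i \<le> m" for i
      using arc[of i] arc[of "m - 1"] that m by (cases "i = m") (auto simp: D_def)
    have distinct: "f i \<noteq> f j" if "i < j" "j \<le> m" for i j
    proof
      assume "f i = f j"
      then have "(a, b) \<in> D ^^ (i + (m - j))"
        using from_a[of i] to_b[of j] that unfolding relpow_add by auto
      moreover have "i + (m - j) < m" using that by linarith
      ultimately show False using IH less.prems by blast
    qed
    have chord: "(f i, f j) \<notin> E" if "Suc i < j" "j \<le> m" for i j
    proof
      assume "(f i, f j) \<in> E"
      then have "(f i, f j) \<in> D" using fu that by (simp add: D_def)
      then have "(a, f j) \<in> D ^^ Suc i" using from_a[of i] that by (auto intro: relpow_Suc_I)
      then have "(a, b) \<in> D ^^ (Suc i + (m - j))"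
        using to_b[of j] that unfolding relpow_add by blast
      moreover have "Suc i + (m - j) < m" using that by linarith
      ultimately show False using IH less.prems by blast
    qed
    \<comment> \<open>If \<open>f i\<close> is a neighbour of \<open>u\<close> at distance at least
      two from \<open>a\<close> along the path, then \<open>a\<close> and \<open>f i\<close> form a
      shorter forbidden pair; the same holds for \<open>f i\<close> and \<open>b\<close>. So only
      the midpoint of a path of length 2 remains.\<close>
    have spoke: "m = 2 \<and> i = 1" if i: "0 < i" "i < m" "(u, f i) \<in> E" for i
    proof -
      have "i < 2"
      proof (rule ccontr)
        assume "\<not> i < 2"
        then show False
          using IH[of i a "f i"] less.prems(1) i distinct[of 0 i] chord[of 0 i] f from_a[of i] by auto
      qed
      moreover have "m - i < 2"
      proof (rule ccontr)
        assume "\<not> m - i < 2"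
        then show False
          using IH[of "m - i" "f i" b] less.prems(2) i distinct[of i m] chord[of i m] f to_b[of i] by auto
      qed
      ultimately show ?thesis using i by auto
    qed
    show False
    proof (cases "\<exists>i. 0 < i \<and> i < m \<and> (u, f i) \<in> E")
      case True
      then have "m = 2" "(u, f 1) \<in> E" using spoke by auto
      then have "(a, f 1) \<in> E" "(f 1, b) \<in> E" using arc[of 0] arc[of 1] f by (auto simp: D_def numeral_2_eq_2)
      then show False
        using not_hull_ineq_induced_diamond[OF E less.prems(3,4) \<open>(u, f 1) \<in> E\<close> less.prems(1)]
          less.prems simpleD(2)[OF E] h by blast
    next
      case False
      \<comment> \<open>The cycle starts at \<open>u\<close> and runs along the \<open>m + 1\<close>
        vertices of the path, so it has length \<open>m + 2\<close>.\<close>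
      define c where "c i = (case i of 0 \<Rightarrow> u | Suc k \<Rightarrow> f k)" for i
      have c: "c 0 = u" "c (Suc k) = f k" for k by (simp_all add: c_def)
      have "\<not> hull_ineq E"
      proof (rule not_hull_ineq_induced_cycle[OF _ E])
        show "4 \<le> m + 2" using m by simp
        show "inj_on c {..<m + 2}"
        proof (rule linorder_inj_onI')
          fix i j assume "i \<in> {..<m + 2}" "j \<in> {..<m + 2}" "i < j"
          then obtain k where k: "j = Suc k" "k \<le> m" "i \<le> k" by (cases j) auto
          show "c i \<noteq> c j"
          proof (cases i)
            case 0
            then show ?thesis using fu k by (metis c)
          next
            case (Suc l)
            then show ?thesis using distinct[of l k] k by (simp add: c)
          qed
        qed
        fix i j assume ij: "i < j" "j < m + 2"
        then obtain k where k: "j = Suc k" "k \<le> m" "i \<le> k" by (cases j) auto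
        show "(c i, c j) \<in> E \<longleftrightarrow> j = Suc i \<or> i = 0 \<and> Suc j = m + 2"
        proof (cases i)
          case 0
          then show ?thesis
            using False[unfolded not_ex, rule_format, of k] less.prems(1,2) f k m
            by (cases "k = 0"; cases "k = m") (auto simp: c)
        next
          case (Suc l)
          then show ?thesis using chord[of l k] arc[of l] k by (cases "k = Suc l") (auto simp: c D_def)
        qed
      qed
      then show False using h by simp
    qed
  qed
qed

text \<open>If some \<open>u\<close> has two non-adjacent neighbours \<open>a\<close> and
  \<open>b\<close>, the component \<open>K\<close> of \<open>a\<close> after deleting
  \<open>u\<close> misses \<open>b\<close>, and \<open>u\<close> is added to both sides. Otherwise
  adjacency is transitive between distinct vertices, so the component of \<open>x\<close> is its
  closed neighbourhood, which misses \<open>y\<close>; the parts are then disjoint.\<close>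

lemma ex_one_sum_decomposition:
  assumes E: "simple E" and h: "hull_ineq E" and V: "E \<subseteq> V \<times> V"
    and xy: "x \<in> V" "y \<in> V" "x \<noteq> y" "(x, y) \<notin> E"
  obtains V1 V2 c where "V1 \<subset> V" "V2 \<subset> V" "V1 \<inter> V2 \<subseteq> {c}" "E \<subseteq> V1 \<times> V1 \<union> V2 \<times> V2"
proof (cases "\<exists>u a b. (u, a) \<in> E \<and> (u, b) \<in> E \<and> a \<noteq> b \<and> (a, b) \<notin> E")
  case True
  then obtain u a b where P: "(u, a) \<in> E" "(u, b) \<in> E" "a \<noteq> b" "(a, b) \<notin> E" by blast
  define D where "D = {(x, y) \<in> E. x \<noteq> u \<and> y \<noteq> u}"
  define K where "K = {z. (a, z) \<in> D\<^sup>*}"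
  have "b \<notin> K"
    using no_connection[OF E h P] by (auto simp: K_def D_def rtrancl_power)
  have "u \<noteq> a" "u \<noteq> b" using P simpleD(3)[OF E] by auto
  have "u \<notin> K"
    using \<open>u \<noteq> a\<close> by (auto simp: K_def D_def elim: rtranclE)
  have Kstep: "q \<in> K" if "p \<in> K" "(p, q) \<in> E" "q \<noteq> u" for p q
  proof -
    have "p \<noteq> u" using that(1) \<open>u \<notin> K\<close> by auto
    then have "(p, q) \<in> D" using that by (auto simp: D_def)
    then show ?thesis using that(1) by (auto simp: K_def intro: rtrancl_into_rtrancl)
  qed
  have "a \<in> K" by (simp add: K_def)
  have uV: "u \<in> V" "a \<in> V" "b \<in> V" using P V by auto
  show ?thesis
  proof (rule that[of "V \<inter> insert u K" "V - K" u])
    show "V \<inter> insert u K \<subset> V" using uV \<open>b \<notin> K\<close> \<open>u \<noteq> b\<close> by auto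
    show "V - K \<subset> V" using uV \<open>a \<in> K\<close> by auto
    show "E \<subseteq> (V \<inter> insert u K) \<times> (V \<inter> insert u K) \<union> (V - K) \<times> (V - K)"
    proof (rule subrelI)
      fix p q assume pq: "(p, q) \<in> E"
      then have "p \<in> V" "q \<in> V" "(q, p) \<in> E" using V simpleD(2)[OF E] by auto
      then show "(p, q) \<in> (V \<inter> insert u K) \<times> (V \<inter> insert u K) \<union> (V - K) \<times> (V - K)"
        using Kstep[OF _ pq] Kstep[OF _ \<open>(q, p) \<in> E\<close>] by blast
    qed
  qed auto
next
  case False
  define K where "K = {z. z = x \<or> (x, z) \<in> E}"
  have Kstep: "q \<in> K" if "p \<in> K" "(p, q) \<in> E" for p q
  proof (cases "p = x \<or> q = x")
    case True
    then show ?thesis using that by (auto simp: K_def)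
  next
    case ne: False
    then have "(p, x) \<in> E" using that simpleD(2)[OF E] by (auto simp: K_def)
    then have "(x, q) \<in> E" using False that(2) ne by blast
    then show ?thesis by (simp add: K_def)
  qed
  show ?thesis
  proof (rule that[of "V \<inter> K" "V - K" x])
    show "V \<inter> K \<subset> V" "V - K \<subset> V" using xy by (auto simp: K_def)
    show "E \<subseteq> (V \<inter> K) \<times> (V \<inter> K) \<union> (V - K) \<times> (V - K)"
    proof (rule subrelI)
      fix p q assume pq: "(p, q) \<in> E"
      then have "p \<in> V" "q \<in> V" "(q, p) \<in> E" using V simpleD(2)[OF E] by auto
      then show "(p, q) \<in> (V \<inter> K) \<times> (V \<inter> K) \<union> (V - K) \<times> (V - K)"
        using Kstep[OF _ pq] Kstep[OF _ \<open>(q, p) \<in> E\<close>] by blast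
    qed
  qed auto
qed

text \<open>The induction is on the vertex set, as splitting off an isolated vertex leaves the edge
  set unchanged.\<close>

lemma ex_adj_iso_cart_prod:
  "finite V \<Longrightarrow> simple E \<Longrightarrow> E \<subseteq> V \<times> V \<Longrightarrow> hull_ineq E \<Longrightarrow>
    \<exists>ns f. (\<forall>n \<in> set ns. n \<ge> 2) \<and>
      adj_iso f (aor_graph E) (cart_prod (map (\<lambda>n. ac (complete_graph n)) ns))"
proof (induction "card V" arbitrary: V E rule: less_induct)
  case less
  note V = less.prems(1) and E = less.prems(2) and EV = less.prems(3) and h = less.prems(4)
  show ?case
  proof (cases "\<exists>x \<in> V. \<exists>y \<in> V. x \<noteq> y \<and> (x, y) \<notin> E")
    case True
    then obtain x y where "x \<in> V" "y \<in> V" "x \<noteq> y" "(x, y) \<notin> E" by blast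
    then obtain V1 V2 c where V12: "V1 \<subset> V" "V2 \<subset> V" "V1 \<inter> V2 \<subseteq> {c}" "E \<subseteq> V1 \<times> V1 \<union> V2 \<times> V2"
      using ex_one_sum_decomposition[OF E h EV] by metis
    have sub: "\<exists>ns f. (\<forall>n \<in> set ns. n \<ge> 2) \<and>
      adj_iso f (aor_graph (E \<inter> W \<times> W)) (cart_prod (map (\<lambda>n. ac (complete_graph n)) ns))" if "W \<subset> V" for W
    proof (rule less.hyps[of W])
      show "card W < card V" "finite W" using that V by (auto simp: psubset_card_mono finite_subset)
      show "simple (E \<inter> W \<times> W)" "E \<inter> W \<times> W \<subseteq> W \<times> W" "hull_ineq (E \<inter> W \<times> W)"
        using E h by (auto simp: simple_Restr hull_ineq_Restr)
    qed
    obtain ns1 f1 ns2 f2 where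
      1: "\<forall>n \<in> set ns1. n \<ge> 2" "adj_iso f1 (aor_graph (E \<inter> V1 \<times> V1)) (cart_prod (map (\<lambda>n. ac (complete_graph n)) ns1))" and
      2: "\<forall>n \<in> set ns2. n \<ge> 2" "adj_iso f2 (aor_graph (E \<inter> V2 \<times> V2)) (cart_prod (map (\<lambda>n. ac (complete_graph n)) ns2))"
      using sub[OF V12(1)] sub[OF V12(2)] by blast
    interpret one_sum "E \<inter> V1 \<times> V1" "E \<inter> V2 \<times> V2" V1 V2 c
      using E V12 by unfold_locales (auto simp: simple_Restr)
    have "(E \<inter> V1 \<times> V1) \<union> (E \<inter> V2 \<times> V2) = E" using V12(4) by auto
    then have "\<exists>f. adj_iso f (aor_graph E) (cart_prod (map (\<lambda>n. ac (complete_graph n)) (ns1 @ ns2)))"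
      using adj_iso_append[OF 1(2) 2(2)] by auto
    moreover have "\<forall>n \<in> set (ns1 @ ns2). n \<ge> 2" using 1(1) 2(1) by auto
    ultimately show ?thesis by blast
  next
    case False
    then have clique: "E = clique V" using EV simpleD(3)[OF E] by (auto simp: clique_def)
    show ?thesis
    proof (cases "card V \<ge> 2")
      case True
      obtain f where "adj_iso f (aor_graph E) (ac (complete_graph (card V)))"
        using adj_iso_clique_ac_complete[OF V] clique by metis
      from adj_iso_comp[OF this adj_iso_singleton] show ?thesis
        using True by (intro exI[of _ "[card V]"]) auto
    next
      case False
      \<comment> \<open>A clique on at most one vertex has no edges and contributes the empty
        product, which keeps every factor at size at least 2.\<close>
      then have "x = y" if "x \<in> V" "y \<in> V" for x y
        using V that card_le_Suc0_iff_eq[of V] by auto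
      then have "E = {}" by (auto simp: clique clique_def)
      then show ?thesis using adj_iso_empty by (intro exI[of _ "[]"]) auto
    qed
  qed
qed

theorem theorem6p2:
  fixes G :: "'a pair_pre_digraph"
  assumes "pair_graph G"
  shows "hull_property (ac G) \<longleftrightarrow>
    (\<exists>ns :: nat list. (\<forall>n \<in> set ns. n \<ge> 2) \<and>
       digraph_iso (with_proj (ac G))
         (with_proj (cart_prod (map (\<lambda>n. ac (complete_graph n)) ns))))"
proof -
  interpret pair_graph G by fact
  have E: "simple (parcs G)" by (rule simple_parcs[OF assms])
  have EV: "parcs G \<subseteq> pverts G \<times> pverts G" using in_arcsD1 in_arcsD2 by auto
  have iso: "digraph_iso (with_proj (ac G)) (with_proj (cart_prod Hs)) \<longleftrightarrow>
      (\<exists>f. adj_iso f (aor_graph (parcs G)) (cart_prod Hs))" for Hs :: "nat rel pair_pre_digraph list"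
    unfolding ac_eq_aor_graph[OF E] by (rule digraph_iso_iff_adj_iso[OF pair_wf_aor_graph pair_wf_cart_prod])
  have hull: "hull_property (ac G) \<longleftrightarrow> hull_ineq (parcs G)"
    unfolding ac_eq_aor_graph[OF E] by (rule hull_property_aor_graph[OF E])
  show ?thesis
    unfolding hull iso
  proof
    assume "hull_ineq (parcs G)"
    from ex_adj_iso_cart_prod[OF pair_finite_verts E EV this]
    show "\<exists>ns. (\<forall>n \<in> set ns. n \<ge> 2) \<and>
        (\<exists>f. adj_iso f (aor_graph (parcs G)) (cart_prod (map (\<lambda>n. ac (complete_graph n)) ns)))"
      by blast
  next
    assume "\<exists>ns. (\<forall>n \<in> set ns. n \<ge> 2) \<and>
        (\<exists>f. adj_iso f (aor_graph (parcs G)) (cart_prod (map (\<lambda>n. ac (complete_graph n)) ns)))"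
    then obtain ns f where f: "adj_iso f (aor_graph (parcs G)) (cart_prod (map (\<lambda>n. ac (complete_graph n)) ns))"
      by blast
    \<comment> \<open>\<open>f\<close> reveals nothing about the shape of \<open>G\<close>, so the
      inequality is established on cliques with the same orientation graph and pulled back along
      \<open>g\<close> and the inverse of \<open>f\<close>.\<close>
    obtain D :: "(nat \<times> nat) rel" and g where D: "simple D" "hull_ineq D"
      and g: "adj_iso g (aor_graph D) (cart_prod (map (\<lambda>n. ac (complete_graph n)) ns))"
      using ex_disjoint_cliques[of ns] by blast
    show "hull_ineq (parcs G)"
      by (rule hull_ineq_adj_iso[OF D(1) E adj_iso_comp[OF g adj_iso_inv[OF f]] D(2)])
  qed
qed

end
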